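(* Let $p>2$ be a prime and let $k$ be any field of characteristic $p$. Then the $T$-space $CP(G_0)$ of $k_0\langle X\rangle$ is not finitely based.
   Context: $X=\{x_i\mid i\ge 0\}$ is a countably infinite set and $k_0\langle X\rangle$ is the free (nonunitary) associative $k$-algebra on $X$. A $T$-space of $k_0\langle X\rangle$ is a linear subspace invariant under every algebra endomorphism of $k_0\langle X\rangle$; for $H\subseteq k_0\langle X\rangle$, $H^{S_0}$ denotes the smallest $T$-space of $k_0\langle X\rangle$ containing $H$. A $T$-space $V$ is finitely based if $V=H^{S_0}$ for some finite $H$. $G_0$ is the infinite-dimensional nonunitary Grassmann algebra over $k$: it has linear basis the products $e_{i_1}e_{i_2}\cdots e_{i_n}$ ($n\ge1$, $i_1<\dots<i_n$) where $e_i$ ($i\ge1$) satisfy $e_ie_j=-e_je_i$ and $e_i^2=0$. $T(G_0)$ is the set of $f\in k_0\langle X\rangle$ lying in the kernel of every algebra homomorphism $k_0\langle X\rangle\to G_0$. A central polynomial of $G_0$ is an $f\in k_0\langle X\rangle\setminus T(G_0)$ whose image under every homomorphism $k_0\langle X\rangle\to G_0$ lies in the centre of $G_0$; $CP(G_0)$ is the $T$-space of $k_0\langle X\rangle$ generated by all central polynomials of $G_0$. *)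

theory Defs
  imports Main "HOL-Computational_Algebra.Primes"
begin

text \<open>An element is a finitely supported coefficient function on words over the
  variable indices (nat list); the empty word has coefficient 0 (nonunitary).\<close>

definition ncpoly :: "(nat list \<Rightarrow> 'k::field) set" where
  "ncpoly = {f. finite {w. f w \<noteq> 0} \<and> f [] = 0}"

definition ncmult :: "(nat list \<Rightarrow> 'k::field) \<Rightarrow> (nat list \<Rightarrow> 'k) \<Rightarrow> (nat list \<Rightarrow> 'k)" where
  "ncmult f g = (\<lambda>w. \<Sum>i\<in>{..length w}. f (take i w) * g (drop i w))"

definition nc_endo :: "((nat list \<Rightarrow> 'k::field) \<Rightarrow> (nat list \<Rightarrow> 'k)) \<Rightarrow> bool" where
  "nc_endo h \<longleftrightarrow>
     (\<forall>f\<in>ncpoly. h f \<in> ncpoly) \<and>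
     (\<forall>f\<in>ncpoly. \<forall>g\<in>ncpoly. h (\<lambda>w. f w + g w) = (\<lambda>w. h f w + h g w)) \<and>
     (\<forall>c. \<forall>f\<in>ncpoly. h (\<lambda>w. c * f w) = (\<lambda>w. c * h f w)) \<and>
     (\<forall>f\<in>ncpoly. \<forall>g\<in>ncpoly. h (ncmult f g) = ncmult (h f) (h g))"

definition T_space :: "(nat list \<Rightarrow> 'k::field) set \<Rightarrow> bool" where
  "T_space V \<longleftrightarrow>
     V \<subseteq> ncpoly \<and> (\<lambda>w. 0) \<in> V \<and>
     (\<forall>f\<in>V. \<forall>g\<in>V. (\<lambda>w. f w + g w) \<in> V) \<and>
     (\<forall>c. \<forall>f\<in>V. (\<lambda>w. c * f w) \<in> V) \<and>
     (\<forall>h. nc_endo h \<longrightarrow> (\<forall>f\<in>V. h f \<in> V))"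

definition T_closure :: "(nat list \<Rightarrow> 'k::field) set \<Rightarrow> (nat list \<Rightarrow> 'k) set" where
  "T_closure H = \<Inter> {V. T_space V \<and> H \<subseteq> V}"

definition finitely_based :: "(nat list \<Rightarrow> 'k::field) set \<Rightarrow> bool" where
  "finitely_based V \<longleftrightarrow> (\<exists>H. finite H \<and> H \<subseteq> ncpoly \<and> V = T_closure H)"

text \<open>Basis element e_{i_1}...e_{i_n} (i_1<...<i_n, n\<ge>1, i_j\<ge>1) is represented by
  the finite nonempty set {i_1,...,i_n} of positive naturals.\<close>

definition grass :: "(nat set \<Rightarrow> 'k::field) set" where
  "grass = {a. finite {S. a S \<noteq> 0} \<and>
                (\<forall>S. a S \<noteq> 0 \<longrightarrow> finite S \<and> S \<noteq> {} \<and> 0 \<notin> S)}"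

text \<open>e_S e_T = 0 if S, T meet, otherwise (-1)^{#inversions} e_{S \<union> T}.\<close>
definition gsign :: "nat set \<Rightarrow> nat set \<Rightarrow> 'k::field" where
  "gsign S T = (-1) ^ card {(s, t). s \<in> S \<and> t \<in> T \<and> t < s}"

definition gmult :: "(nat set \<Rightarrow> 'k::field) \<Rightarrow> (nat set \<Rightarrow> 'k) \<Rightarrow> (nat set \<Rightarrow> 'k)" where
  "gmult a b = (\<lambda>U. \<Sum>(S, T)\<in>{(S, T). S \<union> T = U \<and> S \<inter> T = {}}. gsign S T * a S * b T)"

definition g_hom :: "((nat list \<Rightarrow> 'k::field) \<Rightarrow> (nat set \<Rightarrow> 'k)) \<Rightarrow> bool" where
  "g_hom h \<longleftrightarrow>
     (\<forall>f\<in>ncpoly. h f \<in> grass) \<and>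
     (\<forall>f\<in>ncpoly. \<forall>g\<in>ncpoly. h (\<lambda>w. f w + g w) = (\<lambda>S. h f S + h g S)) \<and>
     (\<forall>c. \<forall>f\<in>ncpoly. h (\<lambda>w. c * f w) = (\<lambda>S. c * h f S)) \<and>
     (\<forall>f\<in>ncpoly. \<forall>g\<in>ncpoly. h (ncmult f g) = gmult (h f) (h g))"

definition T_G0 :: "(nat list \<Rightarrow> 'k::field) set" where
  "T_G0 = {f\<in>ncpoly. \<forall>h. g_hom h \<longrightarrow> h f = (\<lambda>S. 0)}"

definition centre_G0 :: "(nat set \<Rightarrow> 'k::field) set" where
  "centre_G0 = {z\<in>grass. \<forall>a\<in>grass. gmult z a = gmult a z}"

definition central_poly :: "(nat list \<Rightarrow> 'k::field) \<Rightarrow> bool" where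
  "central_poly f \<longleftrightarrow> f \<in> ncpoly \<and> f \<notin> T_G0 \<and> (\<forall>h. g_hom h \<longrightarrow> h f \<in> centre_G0)"

definition CP_G0 :: "(nat list \<Rightarrow> 'k::field) set" where
  "CP_G0 = T_closure {f. central_poly f}"

end

theory Submission
  imports Defs Complex_Main
begin

text \<open>A value \<open>c + a\<close> in the Grassmann algebra (\<open>c\<close> even, \<open>a\<close> odd) behaves like \<open>c + dc\<close>, so that
  polynomials modulo \<open>T(G_0)\<close> are even differential forms over the truncated polynomial ring
  \<open>k[c_0, c_1, ...]/(c_i^p)\<close>; central polynomials are the closed forms and commutators are exact.
  Every endomorphism acts on the cohomology, an exterior algebra on the Cartier classes
  \<open>c_i^(p-1) dc_i\<close>, through its linear part only, and therefore preserves degrees. Hence a central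
  polynomial in \<open>m\<close> variables generates only classes of degree at most \<open>m\<close>, whereas the product of
  \<open>n\<close> polynomials \<open>x^(p-1) [x, y] y^(p-1)\<close> in distinct variables is central with a nonzero class of
  degree \<open>2n\<close>.

  Cohomology classes of top degree are detected by the top coefficient at a generic point of
  \<open>G_0\<close>, which is a trace. Exactness of the components of a central polynomial whose degree in
  some variable is prime to \<open>p\<close> is replaced by the statement that Euler operators map central
  polynomials to sums of commutators modulo \<open>T(G_0)\<close>.\<close>

text \<open>An endomorphism moves the generic point to another point whose values lie in
  \<open>Gen\<close>, the unital subalgebra spanned by words in the generic values. Vanishing
  therefore has to be proved at every point of \<open>G0\<close> with values in \<open>Gen\<close>.
  The top coefficient is no trace on the whole Grassmann algebra, where a product of two odd basis
  elements is half a commutator. On \<open>Gen\<close> it is one: the grading lets only words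
  through in which each of the first \<open>N\<close> variables occurs exactly \<open>p\<close>
  times, and two complementary pieces of such a word commute when \<open>N\<close> is even. Evenness
  of \<open>N\<close> also puts the top monomial, of length \<open>N * (2 * p - 1)\<close>, among
  the even ones, where central values live.

  Since \<open>k\<close> may be finite, rescaling variables cannot separate the homogeneous
  components of a central polynomial. Degrees modulo \<open>p\<close> are still visible to the Euler
  operators, whose eigenvalues lie in the prime field. Subtracting the \<open>(p - 1)\<close>-th
  iterate leaves the words of degree divisible by \<open>p\<close>, and these expand into products
  of Cartier classes with one factor for each variable.\<close>

lemma gsign_union_left:
  assumes "finite S" "finite T" "finite W" "S \<inter> T = {}"
  shows "gsign (S \<union> T) W = (gsign S W * gsign T W :: 'k::field)"
proof -
  let ?I = "\<lambda>S. {(s, t). s \<in> S \<and> t \<in> W \<and> t < s}"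
  have fin: "finite (?I A)" if "finite A" for A :: "nat set"
    by (rule finite_subset[of _ "A \<times> W"]) (use that assms in auto)
  have "?I (S \<union> T) = ?I S \<union> ?I T" "?I S \<inter> ?I T = {}"
    using assms by auto
  then have "card (?I (S \<union> T)) = card (?I S) + card (?I T)"
    using fin assms by (simp add: card_Un_disjoint)
  then show ?thesis
    unfolding gsign_def by (simp only: power_add)
qed

lemma gsign_union_right:
  assumes "finite S" "finite T" "finite W" "T \<inter> W = {}"
  shows "gsign S (T \<union> W) = (gsign S T * gsign S W :: 'k::field)"
proof -
  let ?I = "\<lambda>W. {(s, t). s \<in> S \<and> t \<in> W \<and> t < s}"
  have fin: "finite (?I A)" if "finite A" for A :: "nat set"
    by (rule finite_subset[of _ "S \<times> A"]) (use that assms in auto)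
  have "?I (T \<union> W) = ?I T \<union> ?I W" "?I T \<inter> ?I W = {}"
    using assms by auto
  then have "card (?I (T \<union> W)) = card (?I T) + card (?I W)"
    using fin assms by (simp add: card_Un_disjoint)
  then show ?thesis
    unfolding gsign_def by (simp only: power_add)
qed

lemma gsign_square [simp]: "gsign S T * gsign S T = (1 :: 'k::field)"
  by (simp add: gsign_def flip: power_add mult_2)

lemma gsign_nonzero [simp]: "gsign S T \<noteq> (0 :: 'k::field)"
  by (simp add: gsign_def)

lemma gsign_empty [simp]: "gsign {} T = (1 :: 'k::field)" "gsign S {} = (1 :: 'k::field)"
  by (simp_all add: gsign_def)

text \<open>Each of the \<open>card S * card T\<close> pairs is an inversion in exactly one of the
  two orders.\<close>

lemma gsign_swap:
  assumes "finite S" "finite T" "S \<inter> T = {}"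
  shows "gsign S T = (-1) ^ (card S * card T) * (gsign T S :: 'k::field)"
proof -
  let ?I = "{(s, t). s \<in> S \<and> t \<in> T \<and> t < s}"
  let ?J = "{(t, s). t \<in> T \<and> s \<in> S \<and> s < t}"
  have fin: "finite ?I" "finite (prod.swap ` ?J)"
    by (rule finite_subset[of _ "S \<times> T"]; use assms in auto)+
  have "S \<times> T = ?I \<union> prod.swap ` ?J"
    using assms by (auto simp: image_iff)
  moreover have "?I \<inter> prod.swap ` ?J = {}"
    by auto
  ultimately have "card (S \<times> T) = card ?I + card (prod.swap ` ?J)"
    using fin by (simp only: card_Un_disjoint)
  also have "card (prod.swap ` ?J) = card ?J"
    by (rule card_image) auto
  also have "card (S \<times> T) = card S * card T"
    by (rule card_cartesian_product)
  finally have "(-1) ^ (card S * card T) = (gsign S T * gsign T S :: 'k)"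
    unfolding gsign_def by (simp only: power_add)
  then have "(-1) ^ (card S * card T) * (gsign T S :: 'k) = gsign S T * (gsign T S * gsign T S)"
    by (simp only: mult.assoc)
  then show ?thesis
    by (simp only: gsign_square mult_1_right)
qed

text \<open>In a splitting of \<open>U\<close> the second set is determined by the first. An
  infinite \<open>U\<close> has infinitely many splittings, and there \<open>sum\<close> returns its
  default value 0.\<close>

lemma gmult_eq_sum_Pow:
  assumes "finite U"
  shows "gmult a b U = (\<Sum>S\<in>Pow U. gsign S (U - S) * a S * b (U - S))"
proof -
  have "{(S, T). S \<union> T = U \<and> S \<inter> T = {}} = (\<lambda>S. (S, U - S)) ` Pow U"
    by (auto simp: image_iff)
  moreover have "inj_on (\<lambda>S. (S, U - S)) (Pow U)"
    by (rule inj_onI) simp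
  ultimately show ?thesis
    unfolding gmult_def by (simp add: sum.reindex)
qed

lemma gmult_nonzeroE:
  assumes "gmult a b U \<noteq> 0"
  obtains S T where "U = S \<union> T" "S \<inter> T = {}" "a S \<noteq> 0" "b T \<noteq> 0"
proof -
  have "\<exists>x\<in>{(S, T). S \<union> T = U \<and> S \<inter> T = {}}. (case x of (S, T) \<Rightarrow> gsign S T * a S * b T) \<noteq> 0"
    using assms unfolding gmult_def by (meson sum.neutral)
  then show thesis
    using that by auto
qed

section \<open>The unitary Grassmann algebra as a ring type\<close>

typedef (overloaded) 'k gr =
  "{a :: nat set \<Rightarrow> 'k::field. finite {S. a S \<noteq> 0} \<and> (\<forall>S. a S \<noteq> 0 \<longrightarrow> finite S)}"
  morphisms gcoeff Gr
  by (rule exI[of _ "\<lambda>_. 0"]) auto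

setup_lifting type_definition_gr

lemma finite_supp [simp]: "finite {S. gcoeff a S \<noteq> 0}"
  using gcoeff[of a] by auto

lemma finite_if_gcoeff: "gcoeff a S \<noteq> 0 \<Longrightarrow> finite S"
  using gcoeff[of a] by auto

lemma gr_eqI: "(\<And>S. finite S \<Longrightarrow> gcoeff a S = gcoeff b S) \<Longrightarrow> a = b"
  by (metis finite_if_gcoeff gcoeff_inject ext)

instantiation gr :: (field) ring_1
begin

lift_definition zero_gr :: "'a gr" is "\<lambda>_. 0" by auto

lift_definition one_gr :: "'a gr" is "\<lambda>S. if S = {} then 1 else 0"
  by (auto intro: finite_subset[of _ "{{}}"])

lift_definition plus_gr :: "'a gr \<Rightarrow> 'a gr \<Rightarrow> 'a gr" is "\<lambda>a b S. a S + b S"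
  subgoal for a b
    by (rule conjI, rule finite_subset[of _ "{S. a S \<noteq> 0} \<union> {S. b S \<noteq> 0}"]) (auto, metis add.right_neutral)
  done

lift_definition uminus_gr :: "'a gr \<Rightarrow> 'a gr" is "\<lambda>a S. - a S" by auto

lift_definition minus_gr :: "'a gr \<Rightarrow> 'a gr \<Rightarrow> 'a gr" is "\<lambda>a b S. a S - b S"
  subgoal for a b
    by (rule conjI, rule finite_subset[of _ "{S. a S \<noteq> 0} \<union> {S. b S \<noteq> 0}"]) (auto, metis diff_zero)
  done

lift_definition times_gr :: "'a gr \<Rightarrow> 'a gr \<Rightarrow> 'a gr" is gmult
  subgoal for a b
  proof (rule conjI)
    show "finite {S. gmult a b S \<noteq> 0}" if "finite {S. a S \<noteq> 0} \<and> (\<forall>S. a S \<noteq> 0 \<longrightarrow> finite S)"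
      "finite {S. b S \<noteq> 0} \<and> (\<forall>S. b S \<noteq> 0 \<longrightarrow> finite S)"
      by (rule finite_subset[of _ "(\<lambda>(S, T). S \<union> T) ` ({S. a S \<noteq> 0} \<times> {S. b S \<noteq> 0})"])
        (use that in \<open>auto elim!: gmult_nonzeroE\<close>)
  qed (auto elim!: gmult_nonzeroE)
  done

lemma gcoeff_mult: "finite U \<Longrightarrow>
  gcoeff (a * b) U = (\<Sum>S\<in>Pow U. gsign S (U - S) * gcoeff a S * gcoeff b (U - S))"
  by (simp add: times_gr.rep_eq gmult_eq_sum_Pow)

instance
proof
  fix a b c :: "'a gr"
  show "a + b + c = a + (b + c)" "a + b = b + a" "0 + a = a" "- a + a = 0" "a - b = a + - b"
    by (transfer; simp add: algebra_simps)+
  show "(0 :: 'a gr) \<noteq> 1"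
    by transfer (metis one_neq_zero)
  show "1 * a = a"
  proof (rule gr_eqI)
    fix U :: "nat set" assume "finite U"
    then show "gcoeff (1 * a) U = gcoeff a U"
      by (simp add: gcoeff_mult one_gr.rep_eq if_distrib[of "\<lambda>x. x * _"] if_distrib[of "\<lambda>x. _ * x"] sum.delta cong: if_cong)
  qed
  show "a * 1 = a"
  proof (rule gr_eqI)
    fix U :: "nat set" assume U: "finite U"
    have "gcoeff (a * 1) U = (\<Sum>S\<in>Pow U. if S = U then gcoeff a U else 0)"
      unfolding gcoeff_mult[OF U] by (rule sum.cong) (auto simp: one_gr.rep_eq)
    then show "gcoeff (a * 1) U = gcoeff a U"
      using U by (simp add: sum.delta)
  qed
  show "(a + b) * c = a * c + b * c" "a * (b + c) = a * b + a * c"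
    by (rule gr_eqI; simp add: gcoeff_mult plus_gr.rep_eq algebra_simps sum.distrib)+
  show "a * b * c = a * (b * c)"
  proof (rule gr_eqI)
    fix U :: "nat set" assume U: "finite U"
    then have fin: "finite S" if "S \<subseteq> U" for S
      using that finite_subset by blast
    have "gcoeff (a * b * c) U = (\<Sum>R\<in>Pow U. \<Sum>S\<in>Pow R.
        gsign R (U - R) * (gsign S (R - S) * gcoeff a S * gcoeff b (R - S)) * gcoeff c (U - R))"
      unfolding gcoeff_mult[OF U]
      by (rule sum.cong) (auto simp: gcoeff_mult fin sum_distrib_left sum_distrib_right)
    also have "\<dots> = (\<Sum>(R, S)\<in>Sigma (Pow U) Pow.
        gsign R (U - R) * (gsign S (R - S) * gcoeff a S * gcoeff b (R - S)) * gcoeff c (U - R))"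
      by (rule sum.Sigma) (use U fin in auto)
    \<comment> \<open>Both sides run over ordered partitions of \<open>U\<close> into three pieces,
      \<open>S\<close>, \<open>R - S\<close> and \<open>U - R\<close>. \<open>key\<close> compares
      their signs: inversions add over disjoint unions.\<close>
    also have "\<dots> = (\<Sum>(S, T)\<in>(SIGMA S:Pow U. Pow (U - S)).
        gsign S (U - S) * gcoeff a S * (gsign T (U - S - T) * gcoeff b T * gcoeff c (U - S - T)))"
    proof -
      have key: "gsign S (U - S) * gcoeff a S * (gsign (R - S) (U - S - (R - S)) * gcoeff b (R - S) * gcoeff c (U - S - (R - S))) =
        gsign R (U - R) * (gsign S (R - S) * gcoeff a S * gcoeff b (R - S)) * gcoeff c (U - R)"
        if RS: "R \<subseteq> U" "S \<subseteq> R" for R S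
      proof -
        let ?T = "R - S" and ?W = "U - R"
        have eqs: "U - S - (R - S) = U - R" "S \<union> ?T = R" "?T \<union> ?W = U - S"
          using RS by auto
        have "gsign R ?W = (gsign S ?W * gsign ?T ?W :: 'a)"
          using gsign_union_left[of S ?T ?W, unfolded eqs] fin RS U by auto
        moreover have "gsign S (U - S) = (gsign S ?T * gsign S ?W :: 'a)"
          using gsign_union_right[of S ?T ?W, unfolded eqs] fin RS U by auto
        ultimately show ?thesis
          unfolding eqs(1) by simp
      qed
      show ?thesis
        by (rule sum.reindex_bij_witness[of _ "\<lambda>(S, T). (S \<union> T, S)" "\<lambda>(R, S). (S, R - S)"])
          (use key in auto)
    qed
    also have "\<dots> = (\<Sum>S\<in>Pow U. \<Sum>T\<in>Pow (U - S).
        gsign S (U - S) * gcoeff a S * (gsign T (U - S - T) * gcoeff b T * gcoeff c (U - S - T)))"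
      by (rule sum.Sigma[symmetric]) (use U fin in auto)
    also have "\<dots> = gcoeff (a * (b * c)) U"
      unfolding gcoeff_mult[OF U]
      by (rule sum.cong) (use U in \<open>auto simp: gcoeff_mult sum_distrib_left\<close>)
    finally show "gcoeff (a * b * c) U = gcoeff (a * (b * c)) U" .
  qed
qed

end

lemmas gcoeff_simps [simp] =
  zero_gr.rep_eq plus_gr.rep_eq uminus_gr.rep_eq minus_gr.rep_eq

lemma gcoeff_sum [simp]: "gcoeff (sum f A) S = (\<Sum>x\<in>A. gcoeff (f x) S)"
  by (induction A rule: infinite_finite_induct) auto

lift_definition cst :: "'k::field \<Rightarrow> 'k gr" is "\<lambda>c S. if S = {} then c else 0"
  subgoal for c by (auto intro: finite_subset[of _ "{{}}"])
  done

lemma gcoeff_cst_mult [simp]: "gcoeff (cst c * a) S = c * gcoeff a S"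
proof (cases "finite S")
  case True
  then show ?thesis
    by (simp add: gcoeff_mult cst.rep_eq if_distrib[of "\<lambda>x. x * _"] if_distrib[of "\<lambda>x. _ * x"] sum.delta cong: if_cong)
next
  case False
  then show ?thesis
    by (metis finite_if_gcoeff mult_zero_right)
qed

lemma cst_0 [simp]: "cst 0 = 0"
  by transfer auto

lemma cst_1 [simp]: "cst 1 = 1"
  by transfer auto

lemma cst_add: "cst (c + d) = cst c + cst d"
  by transfer auto

lemma cst_mult: "cst (c * d) = cst c * cst d"
  by (rule gr_eqI) (auto simp: cst.rep_eq)

lemma cst_of_nat: "cst (of_nat n) = of_nat n"
  by (induction n) (auto simp: cst_add)

lemma gcoeff_of_nat_mult [simp]: "gcoeff (of_nat n * a) S = of_nat n * gcoeff a S"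
  by (metis cst_of_nat gcoeff_cst_mult)

lemma mult_cst_commute: "a * cst c = cst c * a"
proof (rule gr_eqI)
  fix U :: "nat set" assume U: "finite U"
  have "gcoeff (a * cst c) U = (\<Sum>S\<in>Pow U. if S = U then c * gcoeff a U else 0)"
    unfolding gcoeff_mult[OF U] by (rule sum.cong) (auto simp: cst.rep_eq)
  then show "gcoeff (a * cst c) U = gcoeff (cst c * a) U"
    using U by (simp add: sum.delta)
qed

lemma mult_cst_left_commute: "a * (cst c * b) = cst c * (a * b)"
  by (metis mult.assoc mult_cst_commute)

lemma cst_mult_cst_mult: "cst c * x * (cst d * y) = cst (c * d) * (x * y)"
  by (metis cst_mult mult.assoc mult_cst_commute)

text \<open>Scalars act as ring elements \<open>cst c\<close>. The interpretation supplies
  \<open>gr.span\<close> and its induction rule, by which statements about words are extended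
  linearly.\<close>

interpretation gr: vector_space "\<lambda>c a. cst c * (a :: 'k::field gr)"
  by unfold_locales (simp_all add: distrib_left distrib_right cst_add cst_mult mult.assoc)

subsection \<open>Parity\<close>

definition is_ev :: "'k::field gr \<Rightarrow> bool" where
  "is_ev a \<longleftrightarrow> (\<forall>S. gcoeff a S \<noteq> 0 \<longrightarrow> even (card S))"

definition is_od :: "'k::field gr \<Rightarrow> bool" where
  "is_od a \<longleftrightarrow> (\<forall>S. gcoeff a S \<noteq> 0 \<longrightarrow> odd (card S))"

lift_definition ev :: "'k::field gr \<Rightarrow> 'k gr" is "\<lambda>a S. if even (card S) then a S else 0"
  subgoal for a by (auto elim!: rev_finite_subset)
  done

lift_definition od :: "'k::field gr \<Rightarrow> 'k gr" is "\<lambda>a S. if odd (card S) then a S else 0"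
  subgoal for a by (auto elim!: rev_finite_subset)
  done

lemma ev_od: "ev a + od a = a"
  by (rule gr_eqI) (auto simp: ev.rep_eq od.rep_eq)

lemma is_ev_ev [simp]: "is_ev (ev a)" and is_od_od [simp]: "is_od (od a)"
  by (auto simp: is_ev_def is_od_def ev.rep_eq od.rep_eq split: if_splits)

lemma is_ev_0 [simp]: "is_ev 0" and is_od_0 [simp]: "is_od 0"
  by (auto simp: is_ev_def is_od_def)

lemma is_ev_1 [simp]: "is_ev 1"
  by (auto simp: is_ev_def one_gr.rep_eq)

lemma is_ev_cst [simp]: "is_ev (cst c)"
  by (auto simp: is_ev_def cst.rep_eq)

lemma is_ev_add [intro]: "is_ev a \<Longrightarrow> is_ev b \<Longrightarrow> is_ev (a + b)"
  by (auto simp: is_ev_def) (metis add.right_neutral)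

lemma is_od_add [intro]: "is_od a \<Longrightarrow> is_od b \<Longrightarrow> is_od (a + b)"
  by (auto simp: is_od_def) (metis add.right_neutral)

lemma is_ev_diff [intro]: "is_ev a \<Longrightarrow> is_ev b \<Longrightarrow> is_ev (a - b)"
  by (auto simp: is_ev_def) (metis diff_zero)

lemma is_ev_sum [intro]: "(\<And>x. x \<in> A \<Longrightarrow> is_ev (f x)) \<Longrightarrow> is_ev (sum f A)"
  by (induction A rule: infinite_finite_induct) auto

lemma ev_od_decomp:
  assumes "is_ev x" "is_od y"
  shows "ev (x + y) = x" "od (x + y) = y"
  using assms by (auto intro!: gr_eqI simp: ev.rep_eq od.rep_eq is_ev_def is_od_def)

lemma is_ev_is_od_eq_0: "is_ev a \<Longrightarrow> is_od a \<Longrightarrow> a = 0"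
  unfolding is_ev_def is_od_def by (intro gr_eqI) auto

lemma gcoeff_mult_nonzeroE:
  assumes "gcoeff (a * b) U \<noteq> 0"
  obtains S T where "U = S \<union> T" "S \<inter> T = {}" "gcoeff a S \<noteq> 0" "gcoeff b T \<noteq> 0"
  using assms by (auto simp: times_gr.rep_eq elim!: gmult_nonzeroE)

lemma card_mult_supp:
  assumes "gcoeff a S \<noteq> 0" "gcoeff b T \<noteq> 0" "S \<inter> T = {}"
  shows "card (S \<union> T) = card S + card T"
  using assms by (simp add: card_Un_disjoint finite_if_gcoeff)

lemma is_ev_mult [intro]: "is_ev a \<Longrightarrow> is_ev b \<Longrightarrow> is_ev (a * b)"
  unfolding is_ev_def by (auto elim!: gcoeff_mult_nonzeroE simp: card_mult_supp)

lemma is_ev_mult_od [intro]: "is_od a \<Longrightarrow> is_od b \<Longrightarrow> is_ev (a * b)"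
  unfolding is_od_def is_ev_def by (auto elim!: gcoeff_mult_nonzeroE simp: card_mult_supp)

lemma is_od_mult1 [intro]: "is_od a \<Longrightarrow> is_ev b \<Longrightarrow> is_od (a * b)"
  unfolding is_od_def is_ev_def by (auto elim!: gcoeff_mult_nonzeroE simp: card_mult_supp)

lemma is_od_mult2 [intro]: "is_ev a \<Longrightarrow> is_od b \<Longrightarrow> is_od (a * b)"
  unfolding is_od_def is_ev_def by (auto elim!: gcoeff_mult_nonzeroE simp: card_mult_supp)

lemma is_ev_power [intro]: "is_ev a \<Longrightarrow> is_ev (a ^ n)"
  by (induction n) auto

lemma ev_add: "ev (a + b) = ev a + ev b" and od_add: "od (a + b) = od a + od b"
  by (auto intro!: gr_eqI simp: ev.rep_eq od.rep_eq)

lemma ev_cst_mult: "ev (cst c * a) = cst c * ev a" and od_cst_mult: "od (cst c * a) = cst c * od a"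
  by (auto intro!: gr_eqI simp: ev.rep_eq od.rep_eq)

lemma ev_0 [simp]: "ev 0 = 0" and od_0 [simp]: "od 0 = 0"
  by (auto intro!: gr_eqI simp: ev.rep_eq od.rep_eq)

lemma od_sum: "od (sum f A) = (\<Sum>x\<in>A. od (f x))"
  by (induction A rule: infinite_finite_induct) (auto simp: od_add)

lemma ev_mult: "ev (a * b) = ev a * ev b + od a * od b"
  and od_mult: "od (a * b) = ev a * od b + od a * ev b"
proof -
  have "a * b = (ev a * ev b + od a * od b) + (ev a * od b + od a * ev b)"
    by (subst (1 2) ev_od[symmetric]) (simp add: algebra_simps)
  moreover have "is_ev (ev a * ev b + od a * od b)" "is_od (ev a * od b + od a * ev b)"
    by (intro is_ev_add is_ev_mult_od is_ev_mult is_od_add is_od_mult1 is_od_mult2 is_ev_ev is_od_od)+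
  ultimately show "ev (a * b) = ev a * ev b + od a * od b" "od (a * b) = ev a * od b + od a * ev b"
    using ev_od_decomp by metis+
qed

text \<open>One computation covers both swap rules: the sign is constantly 1 on the supports if a
  factor is even, and constantly -1 if both are odd.\<close>

lemma gcoeff_mult_swap:
  assumes "\<And>S T. gcoeff a S \<noteq> 0 \<Longrightarrow> gcoeff b T \<noteq> 0 \<Longrightarrow> (-1) ^ (card S * card T) = (c :: 'k)"
  shows "a * b = cst c * (b * a :: 'k::field gr)"
proof (rule gr_eqI)
  fix U :: "nat set" assume U: "finite U"
  have "gcoeff (a * b) U = (\<Sum>T\<in>Pow U. gsign (U - T) T * gcoeff a (U - T) * gcoeff b T)"
    unfolding gcoeff_mult[OF U]
    by (rule sum.reindex_bij_witness[of _ "\<lambda>S. U - S" "\<lambda>S. U - S"]) (auto simp: double_diff)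
  also have "\<dots> = (\<Sum>T\<in>Pow U. c * (gsign T (U - T) * gcoeff b T * gcoeff a (U - T)))"
  proof (rule sum.cong[OF refl])
    fix T assume "T \<in> Pow U"
    then have "gsign (U - T) T = (-1) ^ (card (U - T) * card T) * (gsign T (U - T) :: 'k)"
      using U by (intro gsign_swap) (auto intro: finite_subset)
    then show "gsign (U - T) T * gcoeff a (U - T) * gcoeff b T = c * (gsign T (U - T) * gcoeff b T * gcoeff a (U - T))"
      using assms[of "U - T" T] by (cases "gcoeff a (U - T) = 0 \<or> gcoeff b T = 0") auto
  qed
  also have "\<dots> = gcoeff (cst c * (b * a)) U"
    using U by (simp add: gcoeff_mult sum_distrib_left)
  finally show "gcoeff (a * b) U = gcoeff (cst c * (b * a)) U" .
qed

lemma ev_commute: "is_ev a \<Longrightarrow> a * b = b * a"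
  using gcoeff_mult_swap[of a b 1] by (auto simp: is_ev_def)

lemma ev_left_commute: "is_ev a \<Longrightarrow> b * (a * c) = a * (b * c)"
  by (metis ev_commute mult.assoc)

lemma cst_minus_1: "cst (- 1) = - 1"
  by (rule gr_eqI) (auto simp: cst.rep_eq one_gr.rep_eq)

lemma od_anticommute: "is_od a \<Longrightarrow> is_od b \<Longrightarrow> a * b = - (b * a)"
  using gcoeff_mult_swap[of a b "-1"] by (auto simp: is_od_def cst_minus_1)

text \<open>Even parts commute with everything, so only the product of the odd parts survives, and
  these anticommute.\<close>

lemma commutator_eq:
  "x * y - y * x = 2 * (od x * od y)" for x y :: "'k::field gr"
proof -
  have "x * y = ev x * ev y + ev x * od y + od x * ev y + od x * od y"
    by (subst (1 2) ev_od[symmetric]) (simp add: algebra_simps)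
  moreover have "y * x = ev y * ev x + ev y * od x + od y * ev x + od y * od x"
    by (subst (1 2) ev_od[symmetric]) (simp add: algebra_simps)
  ultimately show ?thesis
    using od_anticommute[of "od x" "od y"] ev_commute[of "ev x"] ev_commute[of "ev y" "od x"]
    by (simp add: mult_2)
qed

lemma is_ev_commutator: "is_ev (x * y - y * x)" for x y :: "'k::field gr"
  unfolding commutator_eq mult_2 by (intro is_ev_add is_ev_mult_od is_od_od)

subsection \<open>Generators\<close>

lift_definition bas :: "nat set \<Rightarrow> 'k::field gr" is "\<lambda>U S. if finite U \<and> S = U then 1 else 0"
  subgoal for U by (auto intro: finite_subset[of _ "{U}"])
  done

lemma bas_mult:
  assumes "finite S" "finite T"
  shows "bas S * bas T = (if S \<inter> T = {} then cst (gsign S T) * bas (S \<union> T) else (0 :: 'k::field gr))"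
proof (rule gr_eqI)
  fix U :: "nat set" assume U: "finite U"
  have "gcoeff (bas S * bas T :: 'k gr) U = (\<Sum>R\<in>Pow U. if R = S then (if U - S = T then gsign S T else 0) else 0)"
    unfolding gcoeff_mult[OF U] by (rule sum.cong) (use assms in \<open>auto simp: bas.rep_eq\<close>)
  also have "\<dots> = (if S \<subseteq> U \<and> U - S = T then gsign S T else 0)"
    using U by (simp add: sum.delta)
  also have "\<dots> = gcoeff (if S \<inter> T = {} then cst (gsign S T) * bas (S \<union> T) else (0 :: 'k gr)) U"
    using assms by (auto simp: bas.rep_eq)
  finally show "gcoeff (bas S * bas T :: 'k gr) U = gcoeff (if S \<inter> T = {} then cst (gsign S T) * bas (S \<union> T) else (0 :: 'k gr)) U" .
qed

lemma gr_expand: "a = (\<Sum>S | gcoeff a S \<noteq> 0. cst (gcoeff a S) * bas S)" (is "_ = ?s") for a :: "'k::field gr"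
proof (rule gr_eqI)
  fix U :: "nat set" assume "finite U"
  have "gcoeff ?s U = (\<Sum>S | gcoeff a S \<noteq> 0. if S = U then gcoeff a U else 0)"
    unfolding gcoeff_sum by (rule sum.cong) (auto simp: bas.rep_eq dest: finite_if_gcoeff)
  then show "gcoeff a U = gcoeff ?s U"
    by simp
qed

abbreviation e :: "nat \<Rightarrow> 'k::field gr" where "e n \<equiv> bas {n}"

lemma is_od_e [simp]: "is_od (e n)"
  by (auto simp: is_od_def bas.rep_eq split: if_splits)

text \<open>Multiplying by a generator absent from the support moves each coefficient from
  \<open>S\<close> to \<open>insert n S\<close>, up to sign. Such fresh generators serve as probes
  below.\<close>

lemma e_cancel:
  assumes "e n * a = 0" "\<And>S. gcoeff a S \<noteq> 0 \<Longrightarrow> n \<notin> S"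
  shows "a = 0"
proof (rule gr_eqI)
  fix S :: "nat set" assume S: "finite S"
  show "gcoeff a S = gcoeff 0 S"
  proof (cases "n \<in> S")
    case True
    then show ?thesis using assms(2) by auto
  next
    case False
    have "gcoeff (e n * a) (insert n S) = (\<Sum>R\<in>Pow (insert n S). if R = {n} then gsign {n} S * gcoeff a S else 0)"
      unfolding gcoeff_mult[OF finite.insertI[OF S]]
      by (rule sum.cong) (use False in \<open>auto simp: bas.rep_eq\<close>)
    also have "\<dots> = gsign {n} S * gcoeff a S"
      using S by (simp add: sum.delta)
    finally show ?thesis
      using assms(1) by simp
  qed
qed

text \<open>All indices from \<open>n\<close> on are fresh, because an even probe needs two
  generators.\<close>

lemma fresh_exists:
  obtains n where "n > 0" "\<And>m S. n \<le> m \<Longrightarrow> gcoeff a S \<noteq> 0 \<Longrightarrow> m \<notin> S"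
proof -
  have "finite (\<Union>{S. gcoeff a S \<noteq> 0})"
    by (intro finite_Union) (auto dest: finite_if_gcoeff)
  then obtain n where "\<forall>m\<in>\<Union>{S. gcoeff a S \<noteq> 0}. m < n"
    using finite_nat_set_iff_bounded by blast
  then have "m < n" if "gcoeff a S \<noteq> 0" "m \<in> S" for m S
    using that by auto
  then show thesis
    using that[of "Suc n"] by (metis Suc_leD leD zero_less_Suc)
qed

subsection \<open>The nonunitary algebra inside the unitary one\<close>

text \<open>The type \<open>gr\<close> contains 1, the value of the empty word, and a generator with
  index 0; this subset recovers the nonunitary algebra of the theorem.\<close>

definition G0 :: "'k::field gr set" where
  "G0 = {a. gcoeff a \<in> grass}"

lemma G0_iff: "a \<in> G0 \<longleftrightarrow> (\<forall>S. gcoeff a S \<noteq> 0 \<longrightarrow> S \<noteq> {} \<and> 0 \<notin> S)"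
  by (auto simp: G0_def grass_def finite_if_gcoeff)

lemma gcoeff_Gr_grass: "a \<in> grass \<Longrightarrow> gcoeff (Gr a) = a"
  by (rule Gr_inverse) (auto simp: grass_def)

lemma Gr_G0: "a \<in> grass \<Longrightarrow> Gr a \<in> G0"
  by (simp add: G0_def gcoeff_Gr_grass)

lemma G0_0 [simp]: "0 \<in> G0"
  by (simp add: G0_iff)

lemma G0_add [intro]: "a \<in> G0 \<Longrightarrow> b \<in> G0 \<Longrightarrow> a + b \<in> G0"
  by (auto simp: G0_iff) (metis add.right_neutral)+

lemma G0_cst [intro]: "a \<in> G0 \<Longrightarrow> cst c * a \<in> G0"
  by (auto simp: G0_iff)

lemma G0_mult [intro]: "a \<in> G0 \<Longrightarrow> b \<in> G0 \<Longrightarrow> a * b \<in> G0"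
  by (auto simp: G0_iff elim!: gcoeff_mult_nonzeroE)

lemma G0_sum [intro]: "(\<And>x. x \<in> A \<Longrightarrow> f x \<in> G0) \<Longrightarrow> sum f A \<in> G0"
  by (induction A rule: infinite_finite_induct) auto

lemma G0_ev [intro]: "a \<in> G0 \<Longrightarrow> ev a \<in> G0" and G0_od [intro]: "a \<in> G0 \<Longrightarrow> od a \<in> G0"
  by (auto simp: G0_iff ev.rep_eq od.rep_eq split: if_splits)

lemma G0_bas [intro]: "S \<noteq> {} \<Longrightarrow> 0 \<notin> S \<Longrightarrow> bas S \<in> G0"
  by (auto simp: G0_iff bas.rep_eq split: if_splits)

subsection \<open>Evaluation of polynomials\<close>

definition evw :: "(nat \<Rightarrow> 'k::field gr) \<Rightarrow> nat list \<Rightarrow> 'k gr" where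
  "evw X w = prod_list (map X w)"

definition evp :: "(nat \<Rightarrow> 'k::field gr) \<Rightarrow> (nat list \<Rightarrow> 'k) \<Rightarrow> 'k gr" where
  "evp X f = (\<Sum>w | f w \<noteq> 0. cst (f w) * evw X w)"

lemma evw_simps [simp]: "evw X [] = 1" "evw X (i # w) = X i * evw X w" "evw X (u @ v) = evw X u * evw X v"
  by (simp_all add: evw_def)

lemma evp_superset:
  assumes "finite A" "\<And>w. f w \<noteq> 0 \<Longrightarrow> w \<in> A"
  shows "evp X f = (\<Sum>w\<in>A. cst (f w) * evw X w)"
  unfolding evp_def by (rule sum.mono_neutral_left) (use assms in auto)

lemma ncpoly_finite: "f \<in> ncpoly \<Longrightarrow> finite {w. f w \<noteq> 0}"
  by (simp add: ncpoly_def)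

lemma ncpoly_0 [simp]: "(\<lambda>w. 0) \<in> ncpoly"
  by (simp add: ncpoly_def)

lemma ncpoly_add [intro]: "f \<in> ncpoly \<Longrightarrow> g \<in> ncpoly \<Longrightarrow> (\<lambda>w. f w + g w) \<in> ncpoly"
  by (auto simp: ncpoly_def intro: finite_subset[of _ "{w. f w \<noteq> 0} \<union> {w. g w \<noteq> 0}"])

lemma ncpoly_diff [intro]: "f \<in> ncpoly \<Longrightarrow> g \<in> ncpoly \<Longrightarrow> (\<lambda>w. f w - g w) \<in> ncpoly"
  by (auto simp: ncpoly_def intro: finite_subset[of _ "{w. f w \<noteq> 0} \<union> {w. g w \<noteq> 0}"])

lemma ncpoly_weight [intro]: "f \<in> ncpoly \<Longrightarrow> (\<lambda>w. c w * f w) \<in> ncpoly"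
  by (auto simp: ncpoly_def elim: rev_finite_subset)

lemma ncmult_nonzeroE:
  assumes "ncmult f g w \<noteq> 0"
  obtains u v where "w = u @ v" "f u \<noteq> 0" "g v \<noteq> 0"
proof -
  have "\<exists>i\<in>{..length w}. f (take i w) * g (drop i w) \<noteq> 0"
    using assms unfolding ncmult_def by (meson sum.neutral)
  then obtain i where "f (take i w) \<noteq> 0" "g (drop i w) \<noteq> 0"
    by auto
  then show thesis
    using that[of "take i w" "drop i w"] by simp
qed

lemma ncpoly_mult [intro]:
  assumes "f \<in> ncpoly" "g \<in> ncpoly"
  shows "ncmult f g \<in> ncpoly"
proof -
  have "finite {w. ncmult f g w \<noteq> 0}"
    by (rule finite_subset[of _ "(\<lambda>(u, v). u @ v) ` ({u. f u \<noteq> 0} \<times> {v. g v \<noteq> 0})"])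
      (use assms in \<open>auto elim!: ncmult_nonzeroE simp: ncpoly_def\<close>)
  then show ?thesis
    using assms by (simp add: ncpoly_def ncmult_def)
qed

lemma evp_add:
  assumes "f \<in> ncpoly" "g \<in> ncpoly"
  shows "evp X (\<lambda>w. f w + g w) = evp X f + evp X g"
proof -
  let ?A = "{w. f w \<noteq> 0} \<union> {w. g w \<noteq> 0}"
  have A: "finite ?A"
    using assms by (simp add: ncpoly_finite)
  have "evp X f = (\<Sum>w\<in>?A. cst (f w) * evw X w)" "evp X g = (\<Sum>w\<in>?A. cst (g w) * evw X w)"
    "evp X (\<lambda>w. f w + g w) = (\<Sum>w\<in>?A. cst (f w + g w) * evw X w)"
    by (rule evp_superset[OF A]; auto)+
  then show ?thesis
    by (simp add: sum.distrib cst_add distrib_right)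
qed

lemma evp_scale: "evp X (\<lambda>w. c * f w) = cst c * evp X f"
  by (cases "c = 0") (simp_all add: evp_def sum_distrib_left)

lemma evp_mult:
  assumes "f \<in> ncpoly" "g \<in> ncpoly"
  shows "evp X (ncmult f g) = evp X f * evp X g"
proof -
  let ?F = "{u. f u \<noteq> 0}" and ?G = "{v. g v \<noteq> 0}"
  let ?W = "(\<lambda>(u, v). u @ v) ` (?F \<times> ?G)"
  let ?t = "\<lambda>(u, v). cst (f u * g v) * evw X (u @ v)"
  let ?S = "SIGMA w:?W. {..length w}"
  have fin: "finite ?F" "finite ?G" "finite ?W"
    using assms by (auto simp: ncpoly_finite)
  have "evp X (ncmult f g) = (\<Sum>w\<in>?W. cst (ncmult f g w) * evw X w)"
    by (rule evp_superset[OF fin(3)]) (auto elim!: ncmult_nonzeroE simp: image_iff)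
  also have "\<dots> = (\<Sum>w\<in>?W. \<Sum>i\<le>length w. ?t (take i w, drop i w))"
  proof (rule sum.cong[OF refl])
    fix w
    have "cst (\<Sum>i\<in>A. h i) = (\<Sum>i\<in>A. cst (h i))" for A and h :: "nat \<Rightarrow> 'a"
      by (induction A rule: infinite_finite_induct) (auto simp: cst_add)
    then show "cst (ncmult f g w) * evw X w = (\<Sum>i\<le>length w. ?t (take i w, drop i w))"
      by (simp add: ncmult_def sum_distrib_right del: evw_simps)
  qed
  also have "\<dots> = (\<Sum>(w, i)\<in>?S. ?t (take i w, drop i w))"
    by (rule sum.Sigma) (use fin in auto)
  \<comment> \<open>A word with a cut position is the same as the pair of its two pieces. Pairs with
    a piece outside its support are dropped in the next step.\<close>
  also have "\<dots> = (\<Sum>x\<in>(\<lambda>(w, i). (take i w, drop i w)) ` ?S. ?t x)"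
  proof (subst sum.reindex)
    show "inj_on (\<lambda>(w, i). (take i w, drop i w)) ?S"
    proof (rule inj_onI; clarify)
      fix w i w' i'
      assume *: "i \<le> length w" "i' \<le> length w'" "take i w = take i' w'" "drop i w = drop i' w'"
      then have "w = w'"
        by (metis append_take_drop_id)
      moreover have "i = i'"
        using * by (metis length_take min.absorb2)
      ultimately show "w = w' \<and> i = i'" ..
    qed
  qed (simp add: case_prod_beta comp_def)
  also have "\<dots> = (\<Sum>x\<in>?F \<times> ?G. ?t x)"
  proof (rule sum.mono_neutral_right)
    show "finite ((\<lambda>(w, i). (take i w, drop i w)) ` ?S)"
      using fin by auto
    show "?F \<times> ?G \<subseteq> (\<lambda>(w, i). (take i w, drop i w)) ` ?S"
    proof clarify
      fix u v assume "f u \<noteq> 0" "g v \<noteq> 0"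
      then show "(u, v) \<in> (\<lambda>(w, i). (take i w, drop i w)) ` ?S"
        by (intro image_eqI[of _ _ "(u @ v, length u)"]) auto
    qed
  qed auto
  also have "\<dots> = evp X f * evp X g"
    unfolding evp_def sum_product sum.cartesian_product
    by (rule sum.cong) (auto simp: cst_mult_cst_mult)
  finally show ?thesis .
qed

lemma evw_G0: "w \<noteq> [] \<Longrightarrow> (\<And>i. X i \<in> G0) \<Longrightarrow> evw X w \<in> G0"
  by (induction w rule: list_nonempty_induct) auto

lemma evp_G0: "f \<in> ncpoly \<Longrightarrow> (\<And>i. X i \<in> G0) \<Longrightarrow> evp X f \<in> G0"
  unfolding evp_def by (intro G0_sum G0_cst evw_G0) (auto simp: ncpoly_def)

lemma g_hom_evp:
  assumes "\<And>i. X i \<in> G0"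
  shows "g_hom (\<lambda>f. gcoeff (evp X f))"
  using assms evp_G0 unfolding g_hom_def
  by (auto simp: evp_add evp_scale evp_mult times_gr.rep_eq[of "evp X _"] G0_def)

section \<open>Homomorphisms are evaluations\<close>

definition mon :: "nat list \<Rightarrow> nat list \<Rightarrow> 'k::field" where
  "mon u = (\<lambda>w. if w = u then 1 else 0)"

lemma mon_ncpoly [intro]: "u \<noteq> [] \<Longrightarrow> mon u \<in> ncpoly"
  by (auto simp: ncpoly_def mon_def)

lemma evp_mon [simp]: "evp X (mon u) = evw X u"
  by (subst evp_superset[of "{u}"]) (auto simp: mon_def split: if_splits)

lemma mon_Cons: "w \<noteq> [] \<Longrightarrow> mon (i # w) = ncmult (mon [i]) (mon w :: nat list \<Rightarrow> 'k::field)"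
proof
  fix u :: "nat list" assume w: "w \<noteq> []"
  show "mon (i # w) u = (ncmult (mon [i]) (mon w) u :: 'k)"
  proof (cases "u = i # w")
    case True
    have "ncmult (mon [i]) (mon w) u = (\<Sum>j\<in>{..length u}. if j = 1 then 1 else (0 :: 'k))"
      unfolding ncmult_def
    proof (rule sum.cong[OF refl])
      fix j show "mon [i] (take j u) * mon w (drop j u) = (if j = 1 then 1 else (0 :: 'k))"
        using w by (cases j) (auto simp: True mon_def take_Cons')
    qed
    also have "\<dots> = 1"
      using w by (simp add: True Suc_le_eq)
    finally show ?thesis
      by (simp add: True mon_def)
  next
    case False
    have "ncmult (mon [i]) (mon w) u = (0 :: 'k)"
    proof (rule ccontr)
      assume "ncmult (mon [i]) (mon w) u \<noteq> (0 :: 'k)"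
      then show False
        using False by (auto elim!: ncmult_nonzeroE simp: mon_def split: if_splits)
    qed
    then show ?thesis
      using False by (simp add: mon_def)
  qed
qed

text \<open>This is the universal property of the free algebra. Multiplicativity settles words, and
  a polynomial is dismantled one word of its support at a time. Outside \<open>ncpoly\<close> the
  function \<open>h\<close> is unconstrained.\<close>

lemma g_hom_eq_evp:
  fixes h :: "(nat list \<Rightarrow> 'k::field) \<Rightarrow> nat set \<Rightarrow> 'k"
  assumes h: "g_hom h"
  obtains X where "\<And>i. X i \<in> G0" "\<And>f. f \<in> ncpoly \<Longrightarrow> h f = gcoeff (evp X f)"
proof -
  define X where "X i = Gr (h (mon [i]))" for i
  have gr: "h f \<in> grass" if "f \<in> ncpoly" for f
    using h that by (auto simp: g_hom_def)
  have X: "X i \<in> G0" and hX: "h (mon [i]) = gcoeff (X i)" for i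
    using gr[OF mon_ncpoly, of "[i]"] by (simp_all add: X_def Gr_G0 gcoeff_Gr_grass)
  have mon: "h (mon w) = gcoeff (evw X w)" if "w \<noteq> []" for w
    using that
  proof (induction w rule: list_nonempty_induct)
    case (cons i w)
    have "h (mon (i # w)) = gmult (h (mon [i])) (h (mon w))"
      unfolding mon_Cons[OF cons.hyps] using h mon_ncpoly[of "[i]", where 'a = 'k] mon_ncpoly[OF cons.hyps, where 'a = 'k]
      by (simp add: g_hom_def)
    then show ?case
      by (simp add: cons.IH hX times_gr.rep_eq)
  qed (simp add: hX)
  have zero: "h (\<lambda>w. 0) = (\<lambda>S. 0)"
  proof -
    have "h (\<lambda>w. 0 * mon [0] w) = (\<lambda>S. 0 * h (mon [0]) S)"
      using h unfolding g_hom_def by (metis mon_ncpoly list.distinct(1))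
    then show ?thesis by simp
  qed
  have "\<forall>f\<in>ncpoly. {w. f w \<noteq> 0} = A \<longrightarrow> h f = gcoeff (evp X f)" if "finite A" for A
    using that
  proof (induction A)
    case empty
    then show ?case
      by (auto simp: evp_def zero)
  next
    case (insert u A)
    show ?case
    proof (intro ballI impI)
      fix f :: "nat list \<Rightarrow> 'k" assume f: "f \<in> ncpoly" "{w. f w \<noteq> 0} = insert u A"
      define g where "g = f(u := 0)"
      have u: "u \<noteq> []"
        using f by (auto simp: ncpoly_def)
      have "{w. g w \<noteq> 0} = A"
        using f(2) insert.hyps by (auto simp: g_def split: if_splits)
      moreover have g: "g \<in> ncpoly"
        using f calculation insert.hyps(1) by (auto simp: ncpoly_def g_def)
      ultimately have IH: "h g = gcoeff (evp X g)"
        using insert.IH by blast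
      have m: "(\<lambda>w. f u * mon u w) \<in> ncpoly"
        using u by auto
      have eq: "f = (\<lambda>w. g w + f u * mon u w)"
        by (auto simp: g_def mon_def)
      have "h (\<lambda>w. g w + f u * mon u w) = (\<lambda>S. h g S + f u * h (mon u) S)"
        using h g m mon_ncpoly[OF u, where 'a = 'k] unfolding g_hom_def by simp
      also have "\<dots> = gcoeff (evp X (\<lambda>w. g w + f u * mon u w))"
        using g m by (simp add: IH mon[OF u] evp_add evp_scale fun_eq_iff)
      finally show "h f = gcoeff (evp X f)"
        by (simp flip: eq)
    qed
  qed
  then have "h f = gcoeff (evp X f)" if "f \<in> ncpoly" for f
    using that ncpoly_finite by blast
  then show thesis
    using that X by blast
qed

subsection \<open>Odd characteristic\<close>

text \<open>The Taylor expansion stops after the linear term. For \<open>n = 0\<close> the truncated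
  exponent \<open>n - 1\<close> is harmless, since its factor \<open>of_nat n\<close>
  vanishes.\<close>

lemma power_add_square_zero:
  fixes a b :: "'a::ring_1"
  assumes "a * b = b * a" "b * b = 0"
  shows "(a + b) ^ n = a ^ n + of_nat n * a ^ (n - 1) * b"
proof (induction n)
  case (Suc n)
  have ba: "b * a ^ m = a ^ m * b" for m
    using assms(1) by (metis power_commuting_commutes)
  have nb: "b * (of_nat n * a ^ (n - 1) * b) = 0"
    by (metis assms(2) ba mult.assoc mult_of_nat_commute mult_zero_right)
  have star: "a * (of_nat n * c) = of_nat n * (a * c)" for c
    by (metis mult.assoc mult_of_nat_commute)
  have na: "a * (of_nat n * a ^ (n - 1) * b) = of_nat n * a ^ n * b"
  proof (cases n)
    case (Suc m)
    then show ?thesis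
      unfolding mult.assoc star by (simp only: diff_Suc_1 power_Suc mult.assoc)
  qed simp
  show ?case
    by (simp add: Suc distrib_left distrib_right ba nb[unfolded One_nat_def] na[unfolded One_nat_def])
qed simp

locale odd_char =
  fixes p :: nat and ty :: "'k::field itself"
  assumes prime_p: "prime p" and p_gt_2: "p > 2" and char_p: "CHAR('k) = p"
begin

lemma of_nat_eq_0_iff: "(of_nat n :: 'k) = 0 \<longleftrightarrow> p dvd n"
  using char_p of_nat_eq_0_iff_char_dvd by metis

lemma of_nat_p_gr: "(of_nat p :: 'k gr) = 0"
  by (metis of_nat_eq_0_iff cst_of_nat cst_0 dvd_refl)

lemma two_neq_0: "(2 :: 'k) \<noteq> 0"
  using of_nat_eq_0_iff[of 2] p_gt_2 by (auto dest: dvd_imp_le)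

lemma double_eq_0: "a + a = 0 \<Longrightarrow> a = 0" for a :: "'k gr"
proof (rule gr_eqI)
  fix S assume "a + a = 0"
  then have "2 * gcoeff a S = 0"
    by (metis mult_2 plus_gr.rep_eq zero_gr.rep_eq)
  then show "gcoeff a S = gcoeff 0 S"
    using two_neq_0 by simp
qed

lemma od_square: "is_od a \<Longrightarrow> a * a = 0" for a :: "'k gr"
  using od_anticommute[of a a] double_eq_0 by (metis add.right_inverse)

text \<open>After splitting \<open>x\<close> by parity, the two copies of \<open>a\<close> can be
  brought together up to sign, and odd elements square to zero.\<close>

lemma od_sandwich:
  fixes a :: "'k gr"
  assumes "is_od a"
  shows "a * (x * a) = 0"
proof -
  have "a * (x * a) = a * ev x * a + a * od x * a"
    by (subst ev_od[of x, symmetric]) (simp add: distrib_left distrib_right mult.assoc)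
  also have "a * ev x * a = ev x * (a * a)"
    by (metis ev_commute is_ev_ev mult.assoc)
  also have "a * od x * a = - (od x * (a * a))"
    using od_anticommute[OF assms is_od_od[of x]] by (simp add: mult.assoc)
  finally show ?thesis
    by (simp add: od_square[OF assms])
qed

text \<open>Every even monomial of positive length squares to zero, so adding one changes a
  \<open>p\<close>-th power by a multiple of \<open>p\<close>. This is the truncation
  \<open>c_i^p = 0\<close> of the coefficient ring of the forms.\<close>

lemma ev_power_p:
  fixes a :: "'k gr"
  assumes "is_ev a" "gcoeff a {} = 0"
  shows "a ^ p = 0"
proof -
  have "(\<Sum>S\<in>A. cst (gcoeff a S) * bas S) ^ p = 0" if "finite A" "A \<subseteq> {S. gcoeff a S \<noteq> 0}" for A
    using that
  proof (induction A)
    case empty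
    then show ?case using p_gt_2 by (simp add: power_0_left)
  next
    case (insert S A)
    let ?b = "cst (gcoeff a S) * bas S"
    have S: "even (card S)" "S \<noteq> {}" "finite S"
      using insert.prems assms by (auto simp: is_ev_def finite_if_gcoeff)
    then have "is_ev ?b"
      by (auto simp: is_ev_def bas.rep_eq)
    moreover have "?b * ?b = 0"
      using S by (simp add: mult.assoc mult_cst_left_commute bas_mult)
    moreover have "(\<Sum>S\<in>A. cst (gcoeff a S) * bas S) ^ p = 0"
      using insert by simp
    ultimately have "((\<Sum>S\<in>A. cst (gcoeff a S) * bas S) + ?b) ^ p = 0"
      using power_add_square_zero[OF ev_commute[symmetric], of ?b "\<Sum>S\<in>A. cst (gcoeff a S) * bas S" p]
      by (simp add: of_nat_p_gr)
    then show ?case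
      using insert.hyps by (simp add: add.commute)
  qed
  from this[OF finite_supp[of a] subset_refl] show ?thesis
    by (subst gr_expand)
qed

lemma G0_ev_power_p: "a \<in> G0 \<Longrightarrow> ev a ^ p = 0" for a :: "'k gr"
  by (rule ev_power_p) (auto simp: G0_iff ev.rep_eq)

text \<open>A fresh generator commutes with a central \<open>z\<close>, hence with its odd part; it
  also anticommutes with that part, which must then vanish.\<close>

lemma centre_iff:
  fixes z :: "'k gr"
  assumes "z \<in> G0"
  shows "gcoeff z \<in> centre_G0 \<longleftrightarrow> is_ev z"
proof
  assume z: "gcoeff z \<in> centre_G0"
  obtain n where n: "n > 0" "\<And>m S. n \<le> m \<Longrightarrow> gcoeff (od z) S \<noteq> 0 \<Longrightarrow> m \<notin> S"
    using fresh_exists by blast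
  have "e n \<in> (G0 :: 'k gr set)"
    using n by auto
  then have "gmult (gcoeff z) (gcoeff (e n)) = gmult (gcoeff (e n)) (gcoeff z)"
    using z by (auto simp: centre_G0_def G0_def)
  then have "z * e n = e n * z"
    by (simp add: gcoeff_inject flip: times_gr.rep_eq)
  moreover have "z * e n = e n * ev z + od z * e n"
    unfolding ev_commute[OF is_ev_ev, symmetric] distrib_right[symmetric] ev_od ..
  moreover have "e n * z = e n * ev z + e n * od z"
    unfolding distrib_left[symmetric] ev_od ..
  ultimately have comm: "od z * e n = e n * od z"
    by (simp only: add_left_cancel)
  have "e n * od z = - (e n * od z)"
    using od_anticommute[OF is_od_e[of n] is_od_od[of z]] unfolding comm .
  then have "e n * od z = 0"
    by (rule double_eq_0[OF iffD1[OF eq_neg_iff_add_eq_0]])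
  then have "od z = 0"
    by (rule e_cancel) (rule n(2)[OF order_refl])
  then show "is_ev z"
    by (metis ev_od add.right_neutral is_ev_ev)
next
  assume "is_ev z"
  then have "z * Gr a = Gr a * z" for a
    by (rule ev_commute)
  then have "gmult (gcoeff z) (gcoeff (Gr a)) = gmult (gcoeff (Gr a)) (gcoeff z)" for a
    by (metis times_gr.rep_eq)
  then show "gcoeff z \<in> centre_G0"
    using assms unfolding centre_G0_def G0_def by (auto simp: gcoeff_Gr_grass) (metis gcoeff_Gr_grass)
qed

subsection \<open>Words whose degrees are divisible by the characteristic\<close>

text \<open>The Cartier class \<open>c^(p-1) dc\<close> for the even part \<open>c\<close> and the odd part \<open>dc\<close>.\<close>

definition q :: "'k gr \<Rightarrow> 'k gr" where
  "q a = od a * ev a ^ (p - 1)"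

lemma is_od_q [simp]: "is_od (q a)"
  unfolding q_def by (intro is_od_mult1 is_od_od is_ev_power is_ev_ev)

lemma parity_prod_list_od:
  assumes "\<And>x. x \<in> set xs \<Longrightarrow> is_od x"
  shows "(even (length xs) \<longrightarrow> is_ev (prod_list xs)) \<and> (odd (length xs) \<longrightarrow> is_od (prod_list xs))"
  using assms by (induction xs) auto

lemma is_ev_prod_q: "even (length xs) \<Longrightarrow> is_ev (prod_list (map q xs))"
  using parity_prod_list_od[of "map q xs"] is_od_q by (metis ex_map_conv length_map)

lemma is_od_prod_q: "odd (length xs) \<Longrightarrow> is_od (prod_list (map q xs))"
  using parity_prod_list_od[of "map q xs"] is_od_q by (metis ex_map_conv length_map)

lemma is_ev_evw: "(\<And>i. is_ev (X i)) \<Longrightarrow> is_ev (evw X w)"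
  by (induction w) auto

text \<open>The terms met when every letter is split into its even and odd part. Even factors go to
  the front, and both lists may be ordered arbitrarily: only the letter content of \<open>w\<close>
  is kept.\<close>

definition parts :: "(nat \<Rightarrow> 'k gr) \<Rightarrow> nat list \<Rightarrow> 'k gr set" where
  "parts X w = {evw (\<lambda>i. ev (X i)) cs * evw (\<lambda>i. od (X i)) es |cs es. mset cs + mset es = mset w}"

lemma span_parts_snoc:
  assumes "x \<in> gr.span (parts X w)"
  shows "x * ev (X j) \<in> gr.span (parts X (w @ [j])) \<and> x * od (X j) \<in> gr.span (parts X (w @ [j]))"
  using assms
proof (induction rule: gr.span_induct_alt)
  case base
  then show ?case by (simp add: gr.span_zero)
next
  case (step c x y)
  from step.hyps(1) obtain cs es where ce: "mset cs + mset es = mset w"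
    "x = evw (\<lambda>i. ev (X i)) cs * evw (\<lambda>i. od (X i)) es"
    by (auto simp: parts_def)
  have "x * ev (X j) = evw (\<lambda>i. ev (X i)) (cs @ [j]) * evw (\<lambda>i. od (X i)) es"
    using ev_commute[OF is_ev_ev, of "X j" "evw (\<lambda>i. od (X i)) es"]
    by (simp only: ce(2) evw_simps mult.assoc mult_1_right)
  moreover have "x * od (X j) = evw (\<lambda>i. ev (X i)) cs * evw (\<lambda>i. od (X i)) (es @ [j])"
    unfolding ce(2) by (simp only: evw_simps mult.assoc mult_1_right)
  moreover have "mset (cs @ [j]) + mset es = mset (w @ [j])" "mset cs + mset (es @ [j]) = mset (w @ [j])"
    using ce(1) by simp_all
  ultimately have x: "x * ev (X j) \<in> parts X (w @ [j])" "x * od (X j) \<in> parts X (w @ [j])"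
    unfolding parts_def by blast+
  have distr: "(cst c * x + y) * z = cst c * (x * z) + y * z" for z
    by (simp only: distrib_right mult.assoc)
  show ?case
    unfolding distr
    by (intro conjI gr.span_add gr.span_scale gr.span_base[OF x(1)] gr.span_base[OF x(2)]
      conjunct1[OF step.IH] conjunct2[OF step.IH])
qed

text \<open>Allows a parity to be prescribed for the value of each piece of a word without leaving
  the span belonging to the whole word, since \<open>ev_mult\<close> and \<open>od_mult\<close> only
  select among the same terms.\<close>

lemma span_parts_append:
  assumes "x \<in> gr.span (parts X u)"
  shows "x * ev (evw X v) \<in> gr.span (parts X (u @ v)) \<and> x * od (evw X v) \<in> gr.span (parts X (u @ v))"
proof (induction v rule: rev_induct)
  case Nil
  have "ev (1 :: 'k gr) = 1" "od (1 :: 'k gr) = 0"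
    using ev_od_decomp[of 1 0] by auto
  then show ?case
    using assms by (simp add: gr.span_zero)
next
  case (snoc j v)
  show ?case
    using span_parts_snoc[OF conjunct1[OF snoc], of j] span_parts_snoc[OF conjunct2[OF snoc], of j]
    by (simp add: ev_mult od_mult distrib_left gr.span_add flip: mult.assoc)
qed

lemma one_in_parts: "1 \<in> gr.span (parts X [])"
  by (rule gr.span_base) (simp add: parts_def)

lemma evw_od_not_distinct:
  assumes "\<not> distinct es"
  shows "evw (\<lambda>i. od (X i)) es = (0 :: 'k gr)"
proof -
  obtain xs y ys zs where "es = xs @ [y] @ ys @ [y] @ zs"
    using not_distinct_decomp[OF assms] by blast
  then have "evw (\<lambda>i. od (X i)) es = evw (\<lambda>i. od (X i)) xs *
    (od (X y) * (evw (\<lambda>i. od (X i)) ys * od (X y)) * evw (\<lambda>i. od (X i)) zs)"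
    by (simp add: mult.assoc)
  then show ?thesis
    by (simp add: od_sandwich)
qed

lemma evw_ev_extract:
  "evw (\<lambda>i. ev (X i)) cs = ev (X j) ^ count (mset cs) j * evw (\<lambda>i. ev (X i)) (filter (\<lambda>i. i \<noteq> j) cs)"
  for X :: "nat \<Rightarrow> 'k gr"
  by (induction cs) (auto simp: mult.assoc ev_left_commute is_ev_power)

lemma evw_parts_eq_prod_q:
  assumes "distinct es" "\<And>j. count (mset cs) j = (if j \<in> set es then p - 1 else 0)"
  shows "evw (\<lambda>i. ev (X i)) cs * evw (\<lambda>i. od (X i)) es = prod_list (map (\<lambda>i. q (X i)) es)"
  using assms
proof (induction es arbitrary: cs)
  case Nil
  then have "cs = []"
    by (metis count_mset_0_iff empty_iff list.set(1) list.set_intros(1) neq_Nil_conv)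
  then show ?case by simp
next
  case (Cons j es)
  let ?cs = "filter (\<lambda>i. i \<noteq> j) cs"
  have "count (mset ?cs) i = (if i \<in> set es then p - 1 else 0)" for i
    using Cons.prems(1) Cons.prems(2)[of i] by (auto simp: count_filter_mset)
  then have IH: "evw (\<lambda>i. ev (X i)) ?cs * evw (\<lambda>i. od (X i)) es = prod_list (map (\<lambda>i. q (X i)) es)"
    using Cons by auto
  have "evw (\<lambda>i. ev (X i)) cs = ev (X j) ^ (p - 1) * evw (\<lambda>i. ev (X i)) ?cs"
    using evw_ev_extract[of X cs j] Cons.prems(2)[of j] by simp
  then have "evw (\<lambda>i. ev (X i)) cs * evw (\<lambda>i. od (X i)) (j # es) =
    od (X j) * ev (X j) ^ (p - 1) * (evw (\<lambda>i. ev (X i)) ?cs * evw (\<lambda>i. od (X i)) es)"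
    by (simp add: mult.assoc ev_left_commute is_ev_power is_ev_evw ev_left_commute[of _ "od (X j)"])
  then show ?case
    by (simp add: IH q_def)
qed

text \<open>In a nonzero term no odd part is repeated and each even part has exponent below
  \<open>p\<close>, so every letter has degree below \<open>2 * p\<close>. Divisibility leaves
  degree 0 or \<open>p\<close>, and degree \<open>p\<close> must split as \<open>p - 1\<close> even
  parts and one odd part: a Cartier class.\<close>

lemma parts_cases:
  assumes X: "\<And>i. X i \<in> G0" and w: "\<And>j. p dvd count (mset w) j" and x: "x \<in> parts X w"
  shows "x = 0 \<or> (\<exists>es. distinct es \<and> set es = set w \<and> x = prod_list (map (\<lambda>i. q (X i)) es))"
proof -
  have "\<exists>es. distinct es \<and> set es = set w \<and> x = prod_list (map (\<lambda>i. q (X i)) es)" if x0: "x \<noteq> 0"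
  proof -
  obtain cs es where ce: "mset cs + mset es = mset w"
    "x = evw (\<lambda>i. ev (X i)) cs * evw (\<lambda>i. od (X i)) es"
    using x by (auto simp: parts_def)
  have dist: "distinct es"
    using x0 ce(2) evw_od_not_distinct by force
  have cs: "count (mset cs) j < p" for j
  proof (rule ccontr)
    assume "\<not> ?thesis"
    then obtain m where "count (mset cs) j = p + m"
      by (metis le_Suc_ex not_less)
    then have "evw (\<lambda>i. ev (X i)) cs = 0"
      by (subst evw_ev_extract[of X cs j]) (simp add: power_add G0_ev_power_p X)
    then show False
      using x0 ce(2) by simp
  qed
  have es: "count (mset es) j = (if j \<in> set es then 1 else 0)" for j
    using dist by (simp add: distinct_count_atmost_1)
  have sum: "count (mset w) j = count (mset cs) j + count (mset es) j" for j
    using ce(1) by (metis count_union)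
  have "count (mset cs) j = (if j \<in> set es then p - 1 else 0)" for j
  proof -
    obtain k where k: "count (mset w) j = p * k"
      using w[of j] by (auto elim: dvdE)
    have "p * k < p * 2"
      using cs[of j] sum[of j] es[of j] p_gt_2 k by (auto split: if_splits)
    then have "k = 0 \<or> k = 1"
      by auto
    then show ?thesis
      using k cs[of j] sum[of j] es[of j] p_gt_2 by (auto split: if_splits)
  qed
  note cs' = this
  have "set es = set w"
  proof (rule set_eqI)
    fix j show "j \<in> set es \<longleftrightarrow> j \<in> set w"
      using sum[of j] cs'[of j] es[of j] p_gt_2 count_mset_0_iff[of w j]
      by (auto split: if_splits)
  qed
  then show "\<exists>es. distinct es \<and> set es = set w \<and> x = prod_list (map (\<lambda>i. q (X i)) es)"
    using evw_parts_eq_prod_q[OF dist cs', of X] dist ce(2) by auto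
  qed
  then show ?thesis by blast
qed

lemma parts_even:
  assumes X: "\<And>i. X i \<in> G0" and w: "\<And>j. p dvd count (mset w) j" and "even (card (set w))"
    and x: "x \<in> gr.span (parts X w)"
  shows "is_ev x"
  using x
proof (induction rule: gr.span_induct_alt)
  case (step c x y)
  from parts_cases[of X, OF X w step.hyps(1)] have "is_ev x"
  proof
    assume "\<exists>es. distinct es \<and> set es = set w \<and> x = prod_list (map (\<lambda>i. q (X i)) es)"
    then obtain es where es: "distinct es" "set es = set w" "x = prod_list (map q (map X es))"
      by (auto simp: comp_def)
    then have "even (length (map X es))"
      using assms(3) by (simp add: distinct_card[symmetric])
    then show "is_ev x"
      unfolding es(3) by (rule is_ev_prod_q)
  qed simp
  then show ?case
    using step.IH by (intro is_ev_add is_ev_mult is_ev_cst)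
qed simp

text \<open>The product is odd by its shape, but as an element of the span of \<open>parts\<close>
  it is a combination of products of evenly many odd classes, hence even.\<close>

lemma ev_od_eq_0:
  assumes X: "\<And>i. X i \<in> G0" and w: "\<And>j. p dvd count (mset (u @ v)) j"
    and "even (card (set (u @ v)))"
  shows "ev (evw X u) * od (evw X v) = (0 :: 'k gr)"
proof (rule is_ev_is_od_eq_0)
  have "1 * ev (evw X u) \<in> gr.span (parts X ([] @ u))"
    using span_parts_append[OF one_in_parts] by blast
  then have "ev (evw X u) * od (evw X v) \<in> gr.span (parts X (u @ v))"
    using span_parts_append[of "ev (evw X u)"] by simp
  then show "is_ev (ev (evw X u) * od (evw X v))"
    using parts_even[of X, OF X w assms(3)] by blast
qed auto

text \<open>Adding \<open>t * od a\<close> to each value \<open>a\<close> of a variable acts on values of words as \<open>1 + t d\<close>, where \<open>d\<close> is the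
  exterior derivative that maps the even part of a value to its odd part.\<close>

lemma evw_shift:
  fixes t :: "'k gr"
  assumes t: "is_od t"
  defines "X' \<equiv> \<lambda>X i. X i + t * od (X i)"
  shows "ev (evw (X' X) w) = ev (evw X w) + t * od (evw X w) \<and> od (evw (X' X) w) = od (evw X w)"
proof (induction w)
  case Nil
  have "ev (1 :: 'k gr) = 1" "od (1 :: 'k gr) = 0"
    using ev_od_decomp[of 1 0] by auto
  then show ?case by simp
next
  case (Cons j w)
  let ?C = "ev (X j)" and ?A = "od (X j)" and ?E = "ev (evw X w)" and ?D = "od (evw X w)"
  have "X' X j = (?C + t * ?A) + ?A"
    unfolding X'_def by (metis ev_od add.assoc add.commute)
  moreover have "is_ev (?C + t * ?A)"
    using t by (intro is_ev_add is_ev_mult_od) auto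
  ultimately have X': "ev (X' X j) = ?C + t * ?A" "od (X' X j) = ?A"
    using ev_od_decomp[of "?C + t * ?A" ?A] by auto
  have tt: "t * (?A * (t * ?D)) = 0"
    by (metis mult.assoc mult_zero_left od_sandwich t)
  have tt': "t * (t * x) = 0" for x
    by (simp add: od_square[OF t] flip: mult.assoc)
  have At: "?A * (t * ?D) = - (t * (?A * ?D))"
    using od_anticommute[OF is_od_od[of "X j"] t] by (simp flip: mult.assoc)
  have Ct: "?C * (t * ?D) = t * (?C * ?D)"
    by (rule ev_left_commute[symmetric]) simp
  show ?case
    by (simp add: ev_mult od_mult X' Cons distrib_left distrib_right mult.assoc tt tt' At Ct)
qed

text \<open>The derivative of \<open>ev_od_eq_0\<close>: shifting the point by a fresh odd
  \<open>e n\<close> adds \<open>e n * od (evw X u)\<close> to the first factor and leaves the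
  second unchanged.\<close>

lemma od_od_eq_0:
  assumes X: "\<And>i. X i \<in> G0" and w: "\<And>j. p dvd count (mset (u @ v)) j"
    and "even (card (set (u @ v)))"
  shows "od (evw X u) * od (evw X v) = (0 :: 'k gr)"
proof -
  obtain n where n: "n > 0" "\<And>m S. n \<le> m \<Longrightarrow> gcoeff (od (evw X u) * od (evw X v)) S \<noteq> 0 \<Longrightarrow> m \<notin> S"
    using fresh_exists by blast
  have en: "e n \<in> (G0 :: 'k gr set)"
    using n by auto
  let ?X' = "\<lambda>i. X i + e n * od (X i)"
  have "?X' i \<in> G0" for i
    by (intro G0_add G0_mult G0_od en X)
  then have "ev (evw ?X' u) * od (evw ?X' v) = 0"
    by (rule ev_od_eq_0) (fact w, fact assms(3))
  then have "(ev (evw X u) + e n * od (evw X u)) * od (evw X v) = 0"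
    unfolding conjunct1[OF evw_shift[OF is_od_e, where X = X]] conjunct2[OF evw_shift[OF is_od_e, where X = X]] .
  then have "e n * (od (evw X u) * od (evw X v)) = 0"
    unfolding distrib_right ev_od_eq_0[of X u v, OF assms] mult.assoc by simp
  then show ?thesis
    by (rule e_cancel) (rule n(2)[OF order_refl])
qed

lemma evw_commute:
  fixes X :: "nat \<Rightarrow> 'k gr"
  assumes "\<And>i. X i \<in> G0" "\<And>j. p dvd count (mset (u @ v)) j" "even (card (set (u @ v)))"
  shows "evw X u * evw X v = evw X v * evw X u"
proof -
  have "evw X u * evw X v - evw X v * evw X u = 0"
    unfolding commutator_eq od_od_eq_0[of X u v, OF assms] by (rule mult_zero_right)
  then show ?thesis
    by (simp only: right_minus_eq)
qed

end

lemma binomial_commuting: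
  fixes a b :: "'a::ring_1"
  assumes ab: "a * b = b * a"
  shows "(a + b) ^ n = (\<Sum>k\<le>n. of_nat (n choose k) * (a ^ k * b ^ (n - k)))"
proof (induction n)
  case (Suc n)
  let ?t = "\<lambda>k. of_nat (n choose k) * (a ^ k * b ^ (n - k))"
  have star: "z * (of_nat m * x) = of_nat m * (z * x)" for m and x z :: 'a
    by (simp only: mult.assoc[symmetric] mult_of_nat_commute[of m z])
  have bk: "b * (a ^ k * x) = a ^ k * (b * x)" for k and x
    by (simp only: mult.assoc[symmetric] power_commuting_commutes[OF ab])
  have A: "a * (\<Sum>k\<le>n. ?t k) = (\<Sum>k\<le>n. of_nat (n choose k) * (a ^ Suc k * b ^ (n - k)))"
    unfolding sum_distrib_left star by (simp only: power_Suc mult.assoc)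
  have "b * (\<Sum>k\<le>n. ?t k) = (\<Sum>k\<le>n. of_nat (n choose k) * (a ^ k * b ^ (Suc n - k)))"
    unfolding sum_distrib_left star
  proof (rule sum.cong[OF refl])
    fix k assume "k \<in> {..n}"
    then have "Suc n - k = Suc (n - k)"
      by auto
    then show "of_nat (n choose k) * (b * (a ^ k * b ^ (n - k))) = of_nat (n choose k) * (a ^ k * b ^ (Suc n - k))"
      by (simp only: power_Suc bk)
  qed
  also have "\<dots> = (\<Sum>k\<le>Suc n. of_nat (n choose k) * (a ^ k * b ^ (Suc n - k)))"
    unfolding sum.atMost_Suc by (simp only: binomial_eq_0[OF lessI] of_nat_0 mult_zero_left add_0_right)
  also have "\<dots> = b ^ Suc n + (\<Sum>k\<le>n. of_nat (n choose Suc k) * (a ^ Suc k * b ^ (n - k)))"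
    unfolding sum.atMost_Suc_shift by (simp only: binomial_n_0 of_nat_1 power_0 mult_1_left diff_zero diff_Suc_Suc)
  finally have B: "b * (\<Sum>k\<le>n. ?t k) = \<dots>" .
  have "(a + b) ^ Suc n = a * (\<Sum>k\<le>n. ?t k) + b * (\<Sum>k\<le>n. ?t k)"
    by (simp only: power_Suc Suc distrib_right)
  also have "\<dots> = b ^ Suc n + (\<Sum>k\<le>n. of_nat (Suc n choose Suc k) * (a ^ Suc k * b ^ (n - k)))"
    unfolding A B binomial_Suc_Suc of_nat_add distrib_right sum.distrib by (rule add.left_commute)
  also have "\<dots> = (\<Sum>k\<le>Suc n. of_nat (Suc n choose k) * (a ^ k * b ^ (Suc n - k)))"
    unfolding sum.atMost_Suc_shift by (simp only: binomial_n_0 of_nat_1 power_0 mult_1_left diff_zero diff_Suc_Suc)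
  finally show ?case .
qed simp

lemma span_mult_closed:
  fixes S :: "'k::field gr set"
  assumes "\<And>s t. s \<in> S \<Longrightarrow> t \<in> S \<Longrightarrow> s * t \<in> gr.span S"
    and "x \<in> gr.span S" "y \<in> gr.span S"
  shows "x * y \<in> gr.span S"
proof -
  have *: "s * y \<in> gr.span S" if "s \<in> S" for s
    using assms(3)
  proof (induction rule: gr.span_induct_alt)
    case (step c t y)
    show ?case
      unfolding distrib_left mult_cst_left_commute
      by (intro gr.span_add gr.span_scale assms(1) that step)
  qed (simp add: gr.span_zero)
  show ?thesis
    using assms(2)
  proof (induction rule: gr.span_induct_alt)
    case (step c s x)
    show ?case
      unfolding distrib_right mult.assoc by (intro gr.span_add gr.span_scale * step)
  qed (simp add: gr.span_zero)
qed

subsection \<open>The generic point\<close>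

text \<open>A multigrading: \<open>sw i s\<close> is the weight of the generator \<open>s\<close> in
  the \<open>i\<close>-th degree, and all degrees are tracked at once.\<close>

definition homog :: "(nat \<Rightarrow> nat \<Rightarrow> nat) \<Rightarrow> 'k::field gr \<Rightarrow> (nat \<Rightarrow> nat) \<Rightarrow> bool" where
  "homog sw x d \<longleftrightarrow> (\<forall>S. gcoeff x S \<noteq> 0 \<longrightarrow> (\<forall>i. (\<Sum>s\<in>S. sw i s) = d i))"

lemma homogD: "homog sw x d \<Longrightarrow> gcoeff x S \<noteq> 0 \<Longrightarrow> (\<Sum>s\<in>S. sw i s) = d i"
  by (simp add: homog_def)

lemma homog_mult:
  assumes "homog sw x d" "homog sw y d'"
  shows "homog sw (x * y) (\<lambda>i. d i + d' i)"
  unfolding homog_def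
proof (intro allI impI)
  fix U i assume "gcoeff (x * y) U \<noteq> 0"
  then obtain S T where ST: "U = S \<union> T" "S \<inter> T = {}" "gcoeff x S \<noteq> 0" "gcoeff y T \<noteq> 0"
    by (rule gcoeff_mult_nonzeroE)
  then have "(\<Sum>s\<in>U. sw i s) = (\<Sum>s\<in>S. sw i s) + (\<Sum>s\<in>T. sw i s)"
    by (simp add: sum.union_disjoint finite_if_gcoeff)
  then show "(\<Sum>s\<in>U. sw i s) = d i + d' i"
    using homogD[OF assms(1) ST(3)] homogD[OF assms(2) ST(4)] by simp
qed

lemma homog_add: "homog sw x d \<Longrightarrow> homog sw y d \<Longrightarrow> homog sw (x + y) d"
  by (auto simp: homog_def) (metis add_0)

lemma homog_sum: "(\<And>x. x \<in> A \<Longrightarrow> homog sw (f x) d) \<Longrightarrow> homog sw (sum f A) d"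
  by (induction A rule: infinite_finite_induct) (auto simp: homog_add, auto simp: homog_def)

lemma homog_1: "homog sw 1 (\<lambda>i. 0)"
  by (auto simp: homog_def one_gr.rep_eq split: if_splits)

lemma homog_power: "homog sw x d \<Longrightarrow> homog sw (x ^ n) (\<lambda>i. n * d i)"
  by (induction n) (auto simp: homog_1 dest: homog_mult)

lemma homog_e: "homog sw (e n) (\<lambda>i. sw i n)"
  by (auto simp: homog_def bas.rep_eq split: if_splits)

context odd_char
begin

text \<open>The generic value of the \<open>i\<close>-th variable lives in the \<open>i\<close>-th block of \<open>2 * p - 1\<close>
  consecutive generators: the first one is its odd part, and the other \<open>2 * (p - 1)\<close> form pairs
  whose sum is its even part, so that the even part has nilpotency index exactly \<open>p\<close>.\<close>

definition blk :: nat where "blk = 2 * p - 1"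

definition gen_od :: "nat \<Rightarrow> 'k gr" where "gen_od i = e (Suc (i * blk))"

definition pair :: "nat \<Rightarrow> nat \<Rightarrow> 'k gr" where
  "pair i j = e (i * blk + 2 + 2 * j) * e (i * blk + 3 + 2 * j)"

definition gen_ev :: "nat \<Rightarrow> 'k gr" where "gen_ev i = (\<Sum>j<p - 1. pair i j)"

definition gen :: "nat \<Rightarrow> 'k gr" where "gen i = gen_ev i + gen_od i"

definition tops :: "nat \<Rightarrow> nat set" where "tops N = {1..N * blk}"

lemma is_ev_pair [simp]: "is_ev (pair i j)"
  unfolding pair_def by (intro is_ev_mult_od is_od_e)

lemma is_ev_gen_ev [simp]: "is_ev (gen_ev i)"
  unfolding gen_ev_def by (intro is_ev_sum is_ev_pair)

lemma is_od_gen_od [simp]: "is_od (gen_od i)"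
  unfolding gen_od_def by (rule is_od_e)

lemma ev_gen: "ev (gen i) = gen_ev i" and od_gen: "od (gen i) = gen_od i"
  unfolding gen_def by (simp_all add: ev_od_decomp)

lemma gen_G0 [simp]: "gen i \<in> G0"
  unfolding gen_def gen_ev_def gen_od_def pair_def
  by (intro G0_add G0_sum G0_mult G0_bas) auto

lemma even_card_top: "even (card (tops N)) \<longleftrightarrow> even N"
  using p_gt_2 by (simp add: tops_def blk_def)

text \<open>Only squarefree products survive, each arising in every order. With
  \<open>r = p - 1\<close> the factorial is invertible modulo \<open>p\<close>, which is why each
  block has \<open>p - 1\<close> pairs.\<close>

lemma sum_pairs_power:
  assumes "\<And>j. is_ev (y j)" "\<And>j. y j * y j = (0 :: 'k gr)"
  shows "(\<Sum>j<r. y j) ^ Suc r = 0 \<and> (\<Sum>j<r. y j) ^ r = of_nat (fact r) * prod_list (map y [0..<r])"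
proof (induction r)
  case (Suc r)
  let ?a = "\<Sum>j<r. y j"
  have comm: "?a * y r = y r * ?a"
    using ev_commute[OF assms(1)] by metis
  note bin = power_add_square_zero[OF comm assms(2)]
  have 1: "(?a + y r) ^ Suc r = of_nat (Suc r) * ?a ^ r * y r"
    unfolding bin diff_Suc_1 conjunct1[OF Suc] by simp
  have 2: "(?a + y r) ^ Suc (Suc r) = 0"
    unfolding bin power_Suc[of ?a "Suc r"] diff_Suc_1 conjunct1[OF Suc] by simp
  show ?case
    using 1 2 unfolding conjunct2[OF Suc]
    by (simp add: mult.assoc of_nat_mult del: of_nat_Suc power_Suc mult_Suc)
qed simp

lemma prod_e_top: "prod_list (map e [1..<Suc m]) = (bas {1..m} :: 'k gr)"
proof (induction m)
  case 0
  show ?case by (auto intro!: gr_eqI simp: bas.rep_eq one_gr.rep_eq)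
next
  case (Suc m)
  have "{(s, t). s \<in> {1..m} \<and> t \<in> {Suc m} \<and> t < s} = {}"
    by auto
  then have "gsign {1..m} {Suc m} = (1 :: 'k)"
    unfolding gsign_def by (simp only: card.empty power_0)
  then have "bas {1..m} * e (Suc m) = (bas {1..Suc m} :: 'k gr)"
    by (subst bas_mult) (auto simp: atLeastAtMostSuc_conv)
  moreover have "[1..<Suc (Suc m)] = [1..<Suc m] @ [Suc m]"
    by simp
  ultimately show ?case
    using Suc by (simp del: upt_Suc)
qed

lemma not_dvd_fact: "n < p \<Longrightarrow> \<not> p dvd fact n"
proof (induction n)
  case 0
  then show ?case using p_gt_2 by simp
next
  case (Suc n)
  then show ?case
    using prime_dvd_mult_iff[OF prime_p, of "Suc n" "fact n"] by (auto dest: dvd_imp_le)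
qed

lemma gen_od_prod_pairs:
  "gen_od i * prod_list (map (pair i) [0..<r]) = prod_list (map e [Suc (i * blk)..<i * blk + 2 + 2 * r])"
proof (induction r)
  case 0
  show ?case by (simp add: gen_od_def)
next
  case (Suc r)
  let ?m = "i * blk + 2 + 2 * r"
  have "[Suc (i * blk)..<i * blk + 2 + 2 * Suc r] = [Suc (i * blk)..<?m] @ [?m, Suc ?m]"
    using upt_Suc_append[of "Suc (i * blk)" "Suc ?m"] upt_Suc_append[of "Suc (i * blk)" ?m] by simp
  moreover have "pair i r = e ?m * e (Suc ?m)"
    unfolding pair_def by (simp add: numeral_3_eq_3)
  moreover have "gen_od i * prod_list (map (pair i) [0..<Suc r]) = gen_od i * prod_list (map (pair i) [0..<r]) * pair i r"
    by (simp add: mult.assoc)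
  ultimately show ?case
    unfolding Suc by (simp add: mult.assoc del: upt_Suc)
qed

lemma q_gen: "q (gen i) = cst (of_nat (fact (p - 1))) * prod_list (map e [Suc (i * blk)..<Suc (Suc i * blk)])"
proof -
  have sandwich: "a * x * a = 0" if "is_od a" for a x :: "'k gr"
    using od_sandwich[OF that, of x] by (simp only: mult.assoc)
  have "pair i j * pair i j = 0" for j
    unfolding pair_def mult.assoc[symmetric] sandwich[OF is_od_e] by (rule mult_zero_left)
  from sum_pairs_power[of "pair i", OF is_ev_pair this, of "p - 1"]
  have 1: "gen_ev i ^ (p - 1) = cst (of_nat (fact (p - 1))) * prod_list (map (pair i) [0..<p - 1])"
    unfolding gen_ev_def cst_of_nat by blast
  have 2: "i * blk + 2 + 2 * (p - 1) = Suc (Suc i * blk)"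
    using p_gt_2 by (simp add: blk_def)
  show ?thesis
    unfolding q_def ev_gen od_gen 1 mult_cst_left_commute gen_od_prod_pairs 2 ..
qed

lemma prod_q_gen:
  "prod_list (map (\<lambda>i. q (gen i)) [0..<N]) = cst (of_nat (fact (p - 1)) ^ N) * bas (tops N)"
proof -
  have "prod_list (map (\<lambda>i. q (gen i)) [0..<N]) = cst (of_nat (fact (p - 1)) ^ N) * prod_list (map e [1..<Suc (N * blk)])"
  proof (induction N)
    case (Suc N)
    have "[1..<Suc (Suc N * blk)] = [1..<Suc (N * blk)] @ [Suc (N * blk)..<Suc (Suc N * blk)]"
      using upt_add_eq_append[of 1 "Suc (N * blk)" blk] by (simp add: add.commute)
    then have "(prod_list (map e [1..<Suc (Suc N * blk)]) :: 'k gr) = prod_list (map e [1..<Suc (N * blk)]) * prod_list (map e [Suc (N * blk)..<Suc (Suc N * blk)])"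
      by (simp only: map_append prod_list.append)
    moreover have "prod_list (map (\<lambda>i. q (gen i)) [0..<Suc N]) = prod_list (map (\<lambda>i. q (gen i)) [0..<N]) * q (gen N)"
      by simp
    ultimately show ?case
      by (simp only: Suc q_gen[of N] power_Suc2 cst_mult_cst_mult)
  qed simp
  then show ?thesis
    unfolding prod_e_top tops_def .
qed

lemma prod_q_gen_top: "gcoeff (prod_list (map (\<lambda>i. q (gen i)) [0..<N])) (tops N) \<noteq> 0"
proof -
  have "finite (tops N)"
    by (simp add: tops_def)
  moreover have "(of_nat (fact (p - 1)) :: 'k) \<noteq> 0"
    using not_dvd_fact[of "p - 1"] p_gt_2 by (simp add: of_nat_eq_0_iff del: of_nat_fact)
  ultimately show ?thesis
    unfolding prod_q_gen by (simp add: bas.rep_eq)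
qed

text \<open>Chosen so that \<open>gen i\<close> is homogeneous of weight 2 in degree \<open>i\<close>; hence the top coefficient
  only sees words in which each of the first \<open>N\<close> variables occurs exactly \<open>p\<close> times.\<close>

definition wt :: "nat \<Rightarrow> nat \<Rightarrow> nat" where
  "wt i s = (if (s - 1) div blk = i then if (s - 1) mod blk = 0 then 2 else 1 else 0)"

lemma wt_blk: "r < blk \<Longrightarrow> wt k (Suc (i * blk + r)) = (if k = i then if r = 0 then 2 else 1 else 0)"
  by (auto simp: wt_def)

lemma homog_gen: "homog wt (gen i) (\<lambda>j. if j = i then 2 else 0)"
proof -
  have blk: "blk > 0" "1 + 2 * j < blk" "2 + 2 * j < blk" if "j < p - 1" for j
    using that by (auto simp: blk_def)
  have "homog wt (pair i j) (\<lambda>k. if k = i then 2 else 0)" if "j < p - 1" for j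
  proof -
    have "wt k (i * blk + 2 + 2 * j) + wt k (i * blk + 3 + 2 * j) = (if k = i then 2 else 0)" for k
      using wt_blk[OF blk(2)[OF that], of k i] wt_blk[OF blk(3)[OF that], of k i] by (simp add: numeral_3_eq_3)
    then show ?thesis
      using homog_mult[OF homog_e homog_e, of wt "i * blk + 2 + 2 * j" "i * blk + 3 + 2 * j"]
      by (simp only: pair_def)
  qed
  then have "homog wt (gen_ev i) (\<lambda>k. if k = i then 2 else 0)"
    unfolding gen_ev_def by (intro homog_sum) simp
  moreover have "homog wt (gen_od i) (\<lambda>k. if k = i then 2 else 0)"
  proof -
    have "wt k (Suc (i * blk)) = (if k = i then 2 else 0)" for k
      using wt_blk[of 0 k i] blk[of 0] p_gt_2 by simp
    then show ?thesis
      using homog_e[of wt "Suc (i * blk)"] by (simp add: gen_od_def)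
  qed
  ultimately show ?thesis
    unfolding gen_def by (rule homog_add)
qed

lemma homog_ev: "homog sw x d \<Longrightarrow> homog sw (ev x) d" and homog_od: "homog sw x d \<Longrightarrow> homog sw (od x) d"
  by (auto simp: homog_def ev.rep_eq od.rep_eq split: if_splits)

lemma homog_q_gen: "homog wt (q (gen i)) (\<lambda>j. if j = i then 2 * p else 0)"
proof -
  have "homog wt (q (gen i)) (\<lambda>j. (if j = i then 2 else 0) + (p - 1) * (if j = i then 2 else 0))"
    unfolding q_def by (intro homog_mult homog_power homog_ev homog_od homog_gen)
  moreover have "(if j = i then 2 else 0) + (p - 1) * (if j = i then 2 else 0) = (if j = i then 2 * p else 0)" for j
    using p_gt_2 by (cases p) simp_all
  ultimately show ?thesis
    by simp
qed

lemma homog_prod_q_gen: "homog wt (prod_list (map (\<lambda>i. q (gen i)) is)) (\<lambda>j. 2 * p * count (mset is) j)"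
proof (induction "is")
  case (Cons i "is")
  have "(if j = i then 2 * p else 0) + 2 * p * count (mset is) j = 2 * p * count (mset (i # is)) j" for j
    by simp
  then show ?case
    using homog_mult[OF homog_q_gen Cons, of i] by simp
qed (simp add: homog_1)

lemma homog_evw_gen: "homog wt (evw gen w) (\<lambda>j. 2 * count (mset w) j)"
proof (induction w)
  case (Cons i w)
  have "(if j = i then 2 else 0) + 2 * count (mset w) j = 2 * count (mset (i # w)) j" for j
    by simp
  then show ?case
    using homog_mult[OF homog_gen Cons, of i] by simp
qed (simp add: homog_1)

text \<open>Read off from a homogeneous element that has \<open>tops N\<close> in its support, in
  place of adding up weights over the blocks.\<close>

lemma wt_top: "(\<Sum>s\<in>tops N. wt i s) = (if i < N then 2 * p else 0)"
  using homogD[OF homog_prod_q_gen prod_q_gen_top, of i N]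
  by (simp add: distinct_count_atmost_1)

text \<open>To reach the weight of \<open>tops N\<close>, every index below \<open>N\<close> must
  occur among the factors.\<close>

lemma prod_q_gen_top_eq_0:
  assumes "length is < N"
  shows "gcoeff (prod_list (map (\<lambda>i. q (gen i)) is)) (tops N) = 0"
proof (rule ccontr)
  assume *: "gcoeff (prod_list (map (\<lambda>i. q (gen i)) is)) (tops N) \<noteq> 0"
  have "(if i < N then 2 * p else 0) = 2 * p * count (mset is) i" for i
    using homogD[OF homog_prod_q_gen *, of i] by (simp only: wt_top)
  then have "i \<in> set is" if "i < N" for i
    using that p_gt_2 by (metis count_mset_0_iff mult_is_0 not_less_zero nat_neq_iff zero_neq_numeral)
  then have "{..<N} \<subseteq> set is"
    by auto
  then have "N \<le> card (set is)"
    using card_mono[of "set is" "{..<N}"] by simp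
  then show False
    using assms card_length[of "is"] by simp
qed

subsection \<open>The top coefficient as a trace\<close>

text \<open>Contains the values of all polynomials at the generic point, hence all points reached
  from it by endomorphisms.\<close>

definition Gen :: "'k gr set" where "Gen = gr.span (range (evw gen))"

lemma Gen_add: "x \<in> Gen \<Longrightarrow> y \<in> Gen \<Longrightarrow> x + y \<in> Gen"
  and Gen_cst: "x \<in> Gen \<Longrightarrow> cst c * x \<in> Gen"
  and Gen_0: "0 \<in> Gen"
  unfolding Gen_def by (simp_all add: gr.span_add gr.span_scale gr.span_zero)

lemma Gen_sum: "(\<And>x. x \<in> A \<Longrightarrow> f x \<in> Gen) \<Longrightarrow> sum f A \<in> Gen"
  unfolding Gen_def by (rule gr.span_sum)

lemma Gen_evw: "evw gen w \<in> Gen"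
  unfolding Gen_def by (rule gr.span_base) simp

lemma Gen_gen: "gen i \<in> Gen" and Gen_1: "1 \<in> Gen"
  using Gen_evw[of "[i]"] Gen_evw[of "[]"] by simp_all

lemma Gen_mult: "x \<in> Gen \<Longrightarrow> y \<in> Gen \<Longrightarrow> x * y \<in> Gen"
  unfolding Gen_def
proof (rule span_mult_closed)
  fix s t assume "s \<in> range (evw gen)" "t \<in> range (evw gen)"
  then obtain u v where "s = evw gen u" "t = evw gen v"
    by blast
  then have "s * t = evw gen (u @ v)"
    by simp
  then show "s * t \<in> gr.span (range (evw gen))"
    by (simp only:) (rule gr.span_base, rule rangeI)
qed

lemma Gen_power: "x \<in> Gen \<Longrightarrow> x ^ n \<in> Gen"
  by (induction n) (auto simp: Gen_1 Gen_mult)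

lemma Gen_evw_subst: "(\<And>i. X i \<in> Gen) \<Longrightarrow> evw X w \<in> Gen"
  by (induction w) (auto simp: Gen_1 Gen_mult)

lemma evp_Gen: "evp gen f \<in> Gen"
  unfolding evp_def by (intro Gen_sum Gen_cst Gen_evw)

text \<open>Weights decide: if the letter content differs from \<open>p\<close> copies of each index
  below \<open>N\<close>, both coefficients vanish; otherwise \<open>evw_commute\<close> applies, as
  the number \<open>N\<close> of letters is even.\<close>

lemma top_trace_words:
  assumes "even N"
  shows "gcoeff (evw gen u * evw gen v) (tops N) = gcoeff (evw gen v * evw gen u) (tops N)"
proof (cases "\<forall>i. count (mset (u @ v)) i = (if i < N then p else 0)")
  case True
  have "set (u @ v) = {..<N}"
  proof (rule set_eqI)
    fix i show "i \<in> set (u @ v) \<longleftrightarrow> i \<in> {..<N}"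
      using True[rule_format, of i] p_gt_2 count_mset_0_iff[of "u @ v" i] by (auto split: if_splits)
  qed
  then have "evw gen u * evw gen v = evw gen v * evw gen u"
    using True assms by (intro evw_commute) auto
  then show ?thesis by simp
next
  case False
  then obtain i where i: "count (mset (u @ v)) i \<noteq> (if i < N then p else 0)"
    by blast
  have "gcoeff (evw gen w) (tops N) = 0" if "count (mset w) i = count (mset (u @ v)) i" for w
  proof (rule ccontr)
    assume *: "gcoeff (evw gen w) (tops N) \<noteq> 0"
    have "(if i < N then 2 * p else 0) = 2 * count (mset w) i"
      using homogD[OF homog_evw_gen *, of i] by (simp only: wt_top)
    then show False
      using i that by (auto split: if_splits)
  qed
  from this[of "u @ v"] this[of "v @ u"] show ?thesis
    by simp
qed

lemma top_trace:
  assumes "even N" "x \<in> Gen" "y \<in> Gen"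
  shows "gcoeff (x * y) (tops N) = gcoeff (y * x) (tops N)"
proof -
  have *: "gcoeff (evw gen u * y) (tops N) = gcoeff (y * evw gen u) (tops N)" for u
    using assms(3) unfolding Gen_def
  proof (induction rule: gr.span_induct_alt)
    case (step c t y)
    then obtain v where t: "t = evw gen v"
      by blast
    show ?case
      unfolding distrib_left distrib_right mult_cst_left_commute mult.assoc t gcoeff_simps gcoeff_cst_mult
        top_trace_words[OF assms(1), of u v] step.IH ..
  qed simp
  show ?thesis
    using assms(2) unfolding Gen_def
  proof (induction rule: gr.span_induct_alt)
    case (step c t x)
    then obtain u where t: "t = evw gen u"
      by blast
    show ?case
      unfolding distrib_left distrib_right mult_cst_left_commute mult.assoc t gcoeff_simps gcoeff_cst_mult
        *[of u] step.IH ..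
  qed simp
qed

section \<open>The chain rule for powers\<close>

lemma power_ev_od:
  fixes z :: "'k gr"
  shows "ev (z ^ k) = ev z ^ k" "od (z ^ k) = of_nat k * ev z ^ (k - 1) * od z"
proof -
  have "(ev z + od z) ^ k = ev z ^ k + of_nat k * ev z ^ (k - 1) * od z"
    by (rule power_add_square_zero[OF ev_commute[OF is_ev_ev] od_square[OF is_od_od]])
  then have z: "z ^ k = ev z ^ k + of_nat k * ev z ^ (k - 1) * od z"
    unfolding ev_od .
  have "is_ev (ev z ^ k)" "is_od (of_nat k * ev z ^ (k - 1) * od z)"
    unfolding cst_of_nat[symmetric] by (intro is_ev_power is_ev_ev is_od_mult2 is_ev_mult is_ev_cst is_od_od)+
  from ev_od_decomp[OF this] show "ev (z ^ k) = ev z ^ k" "od (z ^ k) = of_nat k * ev z ^ (k - 1) * od z"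
    unfolding z by this+
qed

text \<open>In terms of forms, \<open>dc\<close> times \<open>d(c^k)\<close> is zero. Next to
  \<open>od z\<close>, powers of \<open>ev z\<close> may thus be traded for powers of
  \<open>z\<close> itself, which stay in \<open>Gen\<close> when \<open>z\<close> does.\<close>

lemma od_power_absorb:
  fixes z :: "'k gr"
  shows "od z * (x * z ^ k) = od z * (x * ev z ^ k)"
proof -
  have "od z * (x * od (z ^ k)) = od z * ((x * (of_nat k * ev z ^ (k - 1))) * od z)"
    unfolding power_ev_od by (simp only: mult.assoc)
  also have "\<dots> = 0"
    by (rule od_sandwich[OF is_od_od])
  finally have "od z * (x * (ev (z ^ k) + od (z ^ k))) = od z * (x * ev (z ^ k))"
    by (simp only: distrib_left add_0_right)
  then show ?thesis
    unfolding ev_od unfolding power_ev_od(1) .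
qed

subsection \<open>Additivity of \<open>q\<close> modulo odd parts\<close>

lemma dvd_choose: "k < p \<Longrightarrow> 0 < k \<Longrightarrow> p dvd (p choose k)"
proof -
  assume k: "k < p" "0 < k"
  have "p dvd k * (p choose k)"
    unfolding times_binomial_minus1_eq[OF k(2)] by simp
  then show ?thesis
    using prime_dvd_mult_iff[OF prime_p] k by (auto dest: dvd_imp_le)
qed

text \<open>The polynomial \<open>((C + D)^p - C^p - D^p) / p\<close> has integer coefficients, and
  its differential is the defect of additivity of \<open>c^(p-1) dc\<close>. The numbers
  \<open>c j\<close> are these coefficients.\<close>

lemma q_add:
  assumes Y: "Y \<in> Gen" and Z: "Z \<in> Gen"
  obtains b where "b \<in> Gen" "q (Y + Z) = q Y + q Z + od b"
proof -
  define m where "m = p - 1"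
  have p: "p = Suc m" and p1: "p - 1 = m"
    using p_gt_2 by (simp_all add: m_def)
  define c where "c j = (p choose Suc j) div p" for j
  let ?C = "ev Y" and ?A = "od Y" and ?D = "ev Z" and ?B = "od Z"
  have c1: "c j * Suc j = (m choose j)" and c2: "c j * (m - j) = (m choose Suc j)" if "j < m" for j
  proof -
    have "p dvd (p choose Suc j)"
      using that by (intro dvd_choose) (simp_all add: p)
    then have c: "p * c j = (p choose Suc j)"
      by (simp add: c_def)
    have "p * (c j * Suc j) = Suc j * (p choose Suc j)"
      unfolding c[symmetric] by (simp only: ac_simps)
    also have "\<dots> = p * (m choose j)"
      by (subst times_binomial_minus1_eq) (simp_all add: p1[unfolded One_nat_def])
    finally show "c j * Suc j = (m choose j)"
      using p_gt_2 by simp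
    have "p * (c j * (m - j)) = (p - Suc j) * (p choose Suc j)"
    proof -
      have "p - Suc j = m - j"
        by (simp add: p)
      then show ?thesis
        unfolding c[symmetric] by (simp only: ac_simps)
    qed
    also have "\<dots> = p * (m choose Suc j)"
      unfolding binomial_absorb_comp p1 ..
    finally show "c j * (m - j) = (m choose Suc j)"
      using p_gt_2 by simp
  qed
  \<comment> \<open>The exponents \<open>Suc j\<close> and \<open>m - j\<close> add up to
    \<open>p\<close>. The powers are those of \<open>Y\<close> and \<open>Z\<close>, not of their
    even parts, so that \<open>b\<close> remains in \<open>Gen\<close>.\<close>
  define b where "b = (\<Sum>j<m. cst (of_nat (c j)) * (Y ^ Suc j * Z ^ (m - j)))"
  define S1 where "S1 = (\<Sum>j<m. of_nat (m choose j) * (?C ^ j * ?D ^ (m - j)))"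
  define S2 where "S2 = (\<Sum>j<m. of_nat (m choose Suc j) * (?C ^ Suc j * ?D ^ (m - Suc j)))"
  have bin: "(?C + ?D) ^ m = (\<Sum>k\<le>m. of_nat (m choose k) * (?C ^ k * ?D ^ (m - k)))"
    by (rule binomial_commuting) (rule ev_commute[OF is_ev_ev])
  have s1: "(?C + ?D) ^ m = S1 + ?C ^ m"
    unfolding bin S1_def lessThan_Suc_atMost[symmetric] sum.lessThan_Suc by simp
  have s2: "(?C + ?D) ^ m = ?D ^ m + S2"
    unfolding bin S2_def sum.atMost_shift by simp
  have od_b: "od b = ?A * S1 + ?B * S2"
  proof -
    have "od (cst (of_nat (c j)) * (Y ^ Suc j * Z ^ (m - j))) =
      ?A * (of_nat (m choose j) * (?C ^ j * ?D ^ (m - j))) + ?B * (of_nat (m choose Suc j) * (?C ^ Suc j * ?D ^ (m - Suc j)))"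
      (is "?l = ?r") if "j < m" for j
    proof -
      let ?D' = "?D ^ (m - Suc j)"
      have eq: "m - j - 1 = m - Suc j"
        by simp
      have "od (Y ^ Suc j * Z ^ (m - j)) =
        ?C ^ Suc j * (of_nat (m - j) * ?D' * ?B) + of_nat (Suc j) * ?C ^ j * ?A * ?D ^ (m - j)"
        unfolding od_mult power_ev_od eq diff_Suc_1 ..
      also have "?C ^ Suc j * (of_nat (m - j) * ?D' * ?B) = of_nat (m - j) * (?B * (?C ^ Suc j * ?D'))"
      proof -
        have "?C ^ Suc j * (of_nat (m - j) * ?D' * ?B) = of_nat (m - j) * (?C ^ Suc j * ?D' * ?B)"
          unfolding cst_of_nat[symmetric] mult.assoc mult_cst_left_commute[of "?C ^ Suc j"] ..
        also have "?C ^ Suc j * ?D' * ?B = ?B * (?C ^ Suc j * ?D')"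
          by (rule ev_commute) (intro is_ev_mult is_ev_power is_ev_ev)
        finally show ?thesis .
      qed
      also have "of_nat (Suc j) * ?C ^ j * ?A * ?D ^ (m - j) = of_nat (Suc j) * (?A * (?C ^ j * ?D ^ (m - j)))"
        unfolding mult.assoc ev_left_commute[OF is_ev_power[OF is_ev_ev], of ?A Y j] ..
      finally have eq': "od (Y ^ Suc j * Z ^ (m - j)) =
        of_nat (m - j) * (?B * (?C ^ Suc j * ?D')) + of_nat (Suc j) * (?A * (?C ^ j * ?D ^ (m - j)))" .
      have "?l = cst (of_nat (c j)) * (cst (of_nat (m - j)) * (?B * (?C ^ Suc j * ?D'))) +
          cst (of_nat (c j)) * (cst (of_nat (Suc j)) * (?A * (?C ^ j * ?D ^ (m - j))))"
        unfolding od_cst_mult eq' unfolding cst_of_nat by (rule distrib_left)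
      also have "\<dots> = cst (of_nat (m choose Suc j)) * (?B * (?C ^ Suc j * ?D')) +
          cst (of_nat (m choose j)) * (?A * (?C ^ j * ?D ^ (m - j)))"
        unfolding gr.scale_scale of_nat_mult[symmetric] c1[OF that] c2[OF that] ..
      also have "\<dots> = ?r"
        unfolding cst_of_nat[symmetric] mult_cst_left_commute[of ?A] mult_cst_left_commute[of ?B] by (rule add.commute)
      finally show ?thesis .
    qed
    then show ?thesis
      unfolding b_def od_sum S1_def S2_def sum_distrib_left sum.distrib[symmetric] by (intro sum.cong) auto
  qed
  have "q (Y + Z) = ?A * (?C + ?D) ^ m + ?B * (?C + ?D) ^ m"
    unfolding q_def p1 ev_add od_add by (rule distrib_right)
  also have "\<dots> = ?A * (S1 + ?C ^ m) + ?B * (?D ^ m + S2)"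
    by (metis s1 s2)
  also have "\<dots> = q Y + q Z + od b"
    unfolding q_def p1 od_b distrib_left by (simp only: ac_simps)
  finally have "q (Y + Z) = q Y + q Z + od b" .
  moreover have "b \<in> Gen"
    unfolding b_def by (intro Gen_sum Gen_cst Gen_mult Gen_power Y Z)
  ultimately show thesis
    using that by blast
qed

lemma q_cst_mult: "q (cst c * Z) = cst (c ^ p) * q Z"
proof -
  have "(cst c * ev Z) ^ n = cst (c ^ n) * ev Z ^ n" for n
    by (induction n) (simp_all only: power_0 cst_1 mult_1_left power_Suc cst_mult_cst_mult)
  moreover have "c ^ p = c * c ^ (p - 1)"
    using p_gt_2 by (cases p) simp_all
  ultimately show ?thesis
    unfolding q_def ev_cst_mult od_cst_mult by (simp only: cst_mult_cst_mult)
qed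

text \<open>Every term of the expansion contains \<open>C^p\<close>, \<open>D^p\<close> or a
  repeated odd factor. Hence nonlinear words in a substitution contribute nothing to the Cartier
  class.\<close>

lemma q_mult_G0:
  assumes "Y \<in> G0" "Z \<in> G0"
  shows "q (Y * Z) = (0 :: 'k gr)"
proof -
  let ?C = "ev Y" and ?A = "od Y" and ?D = "ev Z" and ?B = "od Z"
  define m where "m = p - 1"
  have p: "p = Suc m" and p1: "p - 1 = m"
    using p_gt_2 by (simp_all add: m_def)
  have Cp: "?C * ?C ^ m = 0" and Dp: "?D * ?D ^ m = 0"
    using G0_ev_power_p[OF assms(1)] G0_ev_power_p[OF assms(2)] unfolding p power_Suc .
  have evAB: "is_ev (?A * ?B)" and evCD: "is_ev (?C * ?D)"
    by (intro is_ev_mult is_ev_mult_od is_ev_ev is_od_od)+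
  have AA: "?A * (x * (?A * y)) = 0" for x y
    using od_sandwich[OF is_od_od, of Y x] by (metis mult.assoc mult_zero_left)
  have BB: "?B * (x * ?B) = 0" for x
    by (rule od_sandwich[OF is_od_od])
  have AAB: "?A * (?A * y) = 0" for y
    using AA[of 1] by simp
  have sq: "?A * ?B * (?A * ?B) = 0"
    unfolding mult.assoc by (rule AA)
  have ev: "ev (Y * Z) ^ m = (?C * ?D) ^ m + of_nat m * (?C * ?D) ^ (m - 1) * (?A * ?B)"
    unfolding ev_mult by (rule power_add_square_zero[OF ev_commute[OF evCD] sq])
  have od0: "od (Y * Z) * (?A * ?B) = 0"
  proof -
    have "?C * ?B * (?A * ?B) = 0"
      unfolding mult.assoc BB by (rule mult_zero_right)
    moreover have "?A * ?D * (?A * ?B) = 0"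
      unfolding mult.assoc by (rule AA)
    ultimately show ?thesis
      unfolding od_mult distrib_right by simp
  qed
  have CD: "(?C * ?D) ^ m = ?C ^ m * ?D ^ m"
  proof (induction m)
    case (Suc n)
    show ?case
      unfolding power_Suc Suc mult.assoc ev_left_commute[OF is_ev_power[OF is_ev_ev], of ?D Y n] ..
  qed simp
  have "q (Y * Z) = od (Y * Z) * (?C ^ m * ?D ^ m) + od (Y * Z) * (of_nat m * (?C * ?D) ^ (m - 1) * (?A * ?B))"
    unfolding q_def p1 ev CD by (rule distrib_left)
  also have "of_nat m * (?C * ?D) ^ (m - 1) * (?A * ?B) = ?A * ?B * (of_nat m * (?C * ?D) ^ (m - 1))"
    by (rule ev_commute[OF evAB, symmetric])
  also have "od (Y * Z) * (?A * ?B * (of_nat m * (?C * ?D) ^ (m - 1))) = 0"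
    unfolding mult.assoc[of "od (Y * Z)" "?A * ?B", symmetric] od0 by (rule mult_zero_left)
  also have "od (Y * Z) * (?C ^ m * ?D ^ m) = 0"
  proof -
    have "?C * ?B * (?C ^ m * ?D ^ m) = ?C * ?C ^ m * (?B * ?D ^ m)"
      unfolding mult.assoc ev_left_commute[OF is_ev_power[OF is_ev_ev], of ?B Y m] ..
    moreover have "?A * ?D * (?C ^ m * ?D ^ m) = ?A * (?C ^ m * (?D * ?D ^ m))"
      unfolding mult.assoc ev_left_commute[OF is_ev_power[OF is_ev_ev], of ?D Y m] ..
    ultimately show ?thesis
      unfolding od_mult distrib_right Cp Dp by simp
  qed
  finally show ?thesis by simp
qed

lemma q_evw_gen: "q (evw gen w) \<in> gr.span (range (\<lambda>i. q (gen i)))"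
proof (cases w)
  case Nil
  have "od (1 :: 'k gr) = 0"
    using ev_od_decomp[of 1 0] by auto
  then have "q (evw gen w) = 0"
    by (simp add: Nil q_def)
  then show ?thesis
    by (simp add: gr.span_zero)
next
  case (Cons i v)
  show ?thesis
  proof (cases "v = []")
    case True
    then show ?thesis
      by (simp add: Cons gr.span_base)
  next
    case False
    then have "q (gen i * evw gen v) = 0"
      by (intro q_mult_G0 gen_G0 evw_G0)
    then show ?thesis
      by (simp add: Cons gr.span_zero)
  qed
qed

text \<open>\<open>q\<close> is additive up to odd parts, semilinear over the \<open>p\<close>-th
  power map, and zero on words of length other than 1, so only the linear part of \<open>Z\<close>
  is left in \<open>r\<close>.\<close>

lemma q_Gen:
  assumes "Z \<in> Gen"
  shows "\<exists>r b. r \<in> gr.span (range (\<lambda>i. q (gen i))) \<and> b \<in> Gen \<and> q Z = r + od b"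
proof -
  \<comment> \<open>Membership is carried through the induction because \<open>q_add\<close>
    requires it of both summands.\<close>
  have "Z \<in> Gen \<and> ?thesis"
    using assms unfolding Gen_def
  proof (induction rule: gr.span_induct_alt)
    case base
    have "q 0 = 0 + od (0 :: 'k gr)"
      by (simp add: q_def)
    then show ?case
      using gr.span_zero by blast
  next
    case (step c x y)
    then obtain w where x: "x = evw gen w"
      by blast
    have y: "y \<in> Gen"
      using step.IH unfolding Gen_def by blast
    obtain r b where rb: "r \<in> gr.span (range (\<lambda>i. q (gen i)))" "b \<in> Gen" "q y = r + od b"
      using step.IH unfolding Gen_def by blast
    have cx: "cst c * x \<in> Gen"
      unfolding x by (intro Gen_cst Gen_evw)
    obtain b' where b': "b' \<in> Gen" "q (cst c * x + y) = q (cst c * x) + q y + od b'"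
      using q_add[OF cx y] by blast
    have "q (cst c * x + y) = (cst (c ^ p) * q x + r) + od (b + b')"
      unfolding b'(2) rb(3) q_cst_mult od_add by (simp only: add.assoc)
    moreover have "cst (c ^ p) * q x + r \<in> gr.span (range (\<lambda>i. q (gen i)))"
      unfolding x by (intro gr.span_add gr.span_scale q_evw_gen rb(1))
    moreover have "b + b' \<in> Gen"
      by (rule Gen_add[OF rb(2) b'(1)])
    ultimately show ?case
      using Gen_add[OF cx y] unfolding Gen_def by blast
  qed
  then show ?thesis ..
qed

lemma od_od_Gen:
  assumes "x \<in> Gen" "y \<in> Gen"
  shows "od x * od y \<in> Gen"
proof -
  have "x * y - y * x = cst 2 * (od x * od y)"
    using commutator_eq[of x y] cst_of_nat[of 2, where 'a = 'k] by simp
  then have "cst (inverse 2) * (x * y - y * x) = od x * od y"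
    using two_neq_0 by simp
  moreover have "x * y - y * x = x * y + cst (- 1) * (y * x)"
    unfolding cst_minus_1 by simp
  then have "x * y - y * x \<in> Gen"
    using assms by (simp only: Gen_add Gen_cst Gen_mult)
  ultimately show ?thesis
    using Gen_cst by metis
qed

text \<open>Factors are taken in pairs: the two odd parts give half a commutator, and
  \<open>od_power_absorb\<close> turns the even powers into powers of elements of
  \<open>Gen\<close>.\<close>

lemma prod_q_Gen:
  assumes "even (length Zs)" "set Zs \<subseteq> Gen"
  shows "prod_list (map q Zs) \<in> Gen"
  using assms
proof (induction Zs rule: induct_list012)
  case (3 Y Z Zs)
  have "q Y * q Z = od Y * od Z * (Z ^ (p - 1) * Y ^ (p - 1))"
  proof -
    have qZ: "q Z = od Z * Z ^ (p - 1)"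
      using od_power_absorb[of Z 1 "p - 1"] unfolding q_def by (simp only: mult_1_left)
    have "q Y * q Z = od Y * (q Z * ev Y ^ (p - 1))"
      unfolding q_def[of Y] mult.assoc ev_commute[OF is_ev_power[OF is_ev_ev], of Y "p - 1" "q Z"] ..
    also have "\<dots> = od Y * (q Z * Y ^ (p - 1))"
      by (rule od_power_absorb[symmetric])
    also have "\<dots> = od Y * od Z * (Z ^ (p - 1) * Y ^ (p - 1))"
      unfolding qZ by (simp only: mult.assoc)
    finally show ?thesis .
  qed
  moreover have "prod_list (map q (Y # Z # Zs)) = q Y * q Z * prod_list (map q Zs)"
    by (simp only: list.map prod_list.Cons mult.assoc)
  ultimately show ?case
    using 3 by (auto intro!: Gen_mult od_od_Gen Gen_power)
qed (auto simp: Gen_1)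

text \<open>The counterpart of "an exact form times closed forms is exact". With \<open>Z\<close>
  the first factor and \<open>W\<close> the even product of the others, the element equals
  \<open>od U * od Z\<close> for \<open>U = b * W * Z ^ (p - 1)\<close>, half a commutator in
  \<open>Gen\<close>, and the trace kills it.\<close>

lemma top_od_prod_q:
  assumes N: "even N" and b: "b \<in> Gen" and Zs: "odd (length Zs)" "set Zs \<subseteq> Gen"
  shows "gcoeff (od b * prod_list (map q Zs)) (tops N) = 0"
proof -
  obtain Z Ws where ZW: "Zs = Z # Ws"
    using Zs(1) by (cases Zs) auto
  define W where "W = prod_list (map q Ws)"
  have W: "is_ev W" "W \<in> Gen"
    using Zs unfolding W_def ZW by (auto intro!: is_ev_prod_q prod_q_Gen)
  have Z: "Z \<in> Gen"
    using Zs ZW by simp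
  define U where "U = b * W * Z ^ (p - 1)"
  have odW: "od W = 0" "ev W = W"
    using ev_od_decomp[OF W(1) is_od_0] by simp_all
  have "od U * od Z = od b * prod_list (map q Zs)"
  proof -
    have bW: "od (b * W) = od b * W"
      unfolding od_mult odW by simp
    have "od (Z ^ (p - 1)) * od Z = 0"
      unfolding power_ev_od(2) mult.assoc od_square[OF is_od_od] by simp
    then have "ev (b * W) * od (Z ^ (p - 1)) * od Z = 0"
      by (simp only: mult.assoc mult_zero_right)
    then have "od U * od Z = od b * W * ev Z ^ (p - 1) * od Z"
      unfolding U_def od_mult[of "b * W"] bW power_ev_od(1) distrib_right by simp
    also have "\<dots> = od b * (od Z * ev Z ^ (p - 1) * W)"
    proof -
      have "W * (ev Z ^ (p - 1) * od Z) = od Z * ev Z ^ (p - 1) * W"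
        unfolding ev_commute[OF is_ev_power[OF is_ev_ev], of Z "p - 1" "od Z"]
        by (rule ev_commute[OF W(1)])
      then show ?thesis
        by (simp only: mult.assoc)
    qed
    finally show ?thesis
      unfolding ZW W_def q_def by simp
  qed
  moreover have "U \<in> Gen"
    unfolding U_def by (intro Gen_mult Gen_power b W Z)
  then have "gcoeff (U * Z - Z * U) (tops N) = 0"
    using top_trace[OF N _ Z] by simp
  then have "2 * gcoeff (od U * od Z) (tops N) = 0"
    unfolding commutator_eq using gcoeff_of_nat_mult[of 2 "od U * od Z" "tops N"] by simp
  ultimately show ?thesis
    using two_neq_0 by simp
qed

text \<open>Each \<open>q Z\<close> is replaced by generic classes, collected in the first list,
  plus an odd part that \<open>top_od_prod_q\<close> kills. In the end fewer than \<open>N\<close>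
  generic classes remain.\<close>

lemma top_prod_q:
  assumes N: "even N" and "even (length is + length Zs)" "length is + length Zs < N" "set Zs \<subseteq> Gen"
  shows "gcoeff (prod_list (map (\<lambda>i. q (gen i)) is) * prod_list (map q Zs)) (tops N) = 0"
  using assms(2-)
proof (induction Zs arbitrary: "is")
  case Nil
  then show ?case
    using prod_q_gen_top_eq_0 by simp
next
  case (Cons Z Zs)
  let ?P = "prod_list (map (\<lambda>i. q (gen i)) is)" and ?R = "prod_list (map q Zs)"
  obtain r b where rb: "r \<in> gr.span (range (\<lambda>i. q (gen i)))" "b \<in> Gen" "q Z = r + od b"
    using q_Gen[of Z] Cons.prems(3) by auto
  have "gcoeff (?P * (r * ?R)) (tops N) = 0"
    using rb(1)
  proof (induction rule: gr.span_induct_alt)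
    case (step c x y)
    then obtain i where x: "x = q (gen i)"
      by blast
    have "gcoeff (prod_list (map (\<lambda>i. q (gen i)) (is @ [i])) * ?R) (tops N) = 0"
      using Cons.prems by (intro Cons.IH) auto
    then have "gcoeff (?P * (x * ?R)) (tops N) = 0"
      by (simp add: x mult.assoc)
    then show ?case
      unfolding distrib_left distrib_right mult.assoc mult_cst_left_commute[of ?P] gcoeff_simps gcoeff_cst_mult step.IH
      by simp
  qed simp
  moreover have "gcoeff (?P * (od b * ?R)) (tops N) = 0"
  proof -
    let ?L = "map gen is"
    have "gcoeff (od b * prod_list (map q (?L @ Zs))) (tops N) = 0"
      using Cons.prems by (intro top_od_prod_q[OF N rb(2)]) (auto simp: Gen_gen)
    moreover have P: "prod_list (map q ?L) = ?P"
      by (simp add: comp_def)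
    \<comment> \<open>The odd part has to be moved to the front; the sign does not affect
      vanishing.\<close>
    have "od b * ?P = ?P * od b \<or> od b * ?P = - (?P * od b)"
    proof (cases "even (length is)")
      case True
      then have "is_ev ?P"
        using is_ev_prod_q[of ?L] P by simp
      then show ?thesis
        using ev_commute by metis
    next
      case False
      then have "is_od ?P"
        using is_od_prod_q[of ?L] P by simp
      then show ?thesis
        using od_anticommute[OF is_od_od] by metis
    qed
    ultimately show ?thesis
      using P by (auto simp: mult.assoc[symmetric])
  qed
  ultimately show ?case
    by (simp add: rb(3) distrib_left distrib_right)
qed

end

subsection \<open>Euler operators\<close>

text \<open>The common shape of derivatives in the letter \<open>i\<close>: \<open>F\<close>
  receives what stands to the left and to the right of an occurrence.\<close>

definition occ :: "nat \<Rightarrow> (nat list \<Rightarrow> nat list \<Rightarrow> 'k::field gr) \<Rightarrow> nat list \<Rightarrow> 'k gr" where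
  "occ i F w = (\<Sum>r<length w. if w ! r = i then F (take r w) (drop (Suc r) w) else 0)"

lemma occ_Nil [simp]: "occ i F [] = 0"
  by (simp add: occ_def)

lemma occ_Cons: "occ i F (j # w) = (if j = i then F [] w else 0) + occ i (\<lambda>u. F (j # u)) w"
  unfolding occ_def by (simp add: sum.lessThan_Suc_shift del: sum.lessThan_Suc cong: if_cong)

lemma occ_const: "occ i (\<lambda>u v. H (u @ i # v)) w = of_nat (count (mset w) i) * H w"
proof (induction w arbitrary: H)
  case (Cons j w)
  show ?case
    unfolding occ_Cons append_Cons Cons.IH[of "\<lambda>x. H (j # x)"] by (simp add: distrib_right)
qed simp

lemma occ_diff: "occ i (\<lambda>u v. F u v - G u v) w = occ i F w - occ i G w"
  unfolding occ_def sum_subtractf[symmetric] by (rule sum.cong) auto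

lemma occ_add: "occ i (\<lambda>u v. F u v + G u v) w = occ i F w + occ i G w"
  unfolding occ_def sum.distrib[symmetric] by (rule sum.cong) auto

lemma occ_mult: "x * occ i F w = occ i (\<lambda>u v. x * F u v) w"
  unfolding occ_def sum_distrib_left by (rule sum.cong) auto

lemma is_ev_occ: "(\<And>u v. is_ev (F u v)) \<Longrightarrow> is_ev (occ i F w)"
  unfolding occ_def by (intro is_ev_sum) auto

text \<open>Terms with two copies of \<open>t\<close> vanish by hypothesis, so the first-order
  expansion is exact.\<close>

lemma evw_shift_var:
  assumes t: "\<And>x. t * (x * t) = (0 :: 'k::field gr)"
  shows "evw (X(i := X i + t)) w = evw X w + occ i (\<lambda>u v. evw X u * (t * evw X v)) w"
proof (induction w)
  case (Cons j w)
  let ?o = "occ i (\<lambda>u v. evw X u * (t * evw X v)) w"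
  have "t * (evw X u * (t * evw X v)) = 0" for u v
    using t[of "evw X u"] by (metis mult.assoc mult_zero_left)
  then have to: "t * ?o = 0"
    unfolding occ_mult by (simp add: occ_def)
  have "occ i (\<lambda>u v. evw X u * (t * evw X v)) (j # w) = (if j = i then t * evw X w else 0) + X j * ?o"
    unfolding occ_Cons occ_mult evw_simps mult.assoc by simp
  then show ?case
    unfolding evw_simps Cons.IH using to by (simp add: distrib_left distrib_right)
qed simp

text \<open>Up to commutators, \<open>t * cyc X i f\<close> is the part of \<open>f (X(i := X i + t))\<close> linear in \<open>t\<close>.\<close>

definition cyc :: "(nat \<Rightarrow> 'k::field gr) \<Rightarrow> nat \<Rightarrow> (nat list \<Rightarrow> 'k) \<Rightarrow> 'k gr" where
  "cyc X i f = (\<Sum>w | f w \<noteq> 0. cst (f w) * occ i (\<lambda>u v. evw X v * evw X u) w)"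

definition central_or_T :: "(nat list \<Rightarrow> 'k::field) \<Rightarrow> bool" where
  "central_or_T f \<longleftrightarrow> f \<in> ncpoly \<and> (\<forall>X. (\<forall>i. X i \<in> G0) \<longrightarrow> is_ev (evp X f))"

lemma central_or_T_diff:
  assumes "central_or_T f" "central_or_T g"
  shows "central_or_T (\<lambda>w. f w - g w)"
proof -
  have fg: "f \<in> ncpoly" "g \<in> ncpoly"
    using assms by (simp_all add: central_or_T_def)
  have g': "(\<lambda>w. - 1 * g w) \<in> ncpoly"
    by (rule ncpoly_weight[OF fg(2)])
  have eq: "evp X (\<lambda>w. f w - g w) = evp X f - evp X g" for X
    using evp_add[OF fg(1) g', of X] unfolding evp_scale cst_minus_1 by simp
  show ?thesis
    unfolding central_or_T_def eq using assms ncpoly_diff[OF fg]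
    by (intro conjI allI impI is_ev_diff) (simp_all add: central_or_T_def)
qed

definition euler :: "nat \<Rightarrow> (nat list \<Rightarrow> 'k::field) \<Rightarrow> nat list \<Rightarrow> 'k" where
  "euler i f = (\<lambda>w. of_nat (count (mset w) i) * f w)"

lemma euler_ncpoly: "f \<in> ncpoly \<Longrightarrow> euler i f \<in> ncpoly"
  unfolding euler_def by (rule ncpoly_weight)

text \<open>Rotating \<open>u @ i # v\<close> to \<open>i # v @ u\<close> costs a commutator, and
  the rotated words have a common left factor \<open>X i\<close>.\<close>

lemma evp_euler:
  assumes "f \<in> ncpoly"
  shows "evp X (euler i f) = (\<Sum>w | f w \<noteq> 0. cst (f w) * occ i (\<lambda>u v. evw X u * evw X (i # v) - evw X (i # v) * evw X u) w) + X i * cyc X i f"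
proof -
  have "evp X (euler i f) = (\<Sum>w | f w \<noteq> 0. cst (euler i f w) * evw X w)"
    by (rule evp_superset) (use assms in \<open>auto simp: ncpoly_finite euler_def\<close>)
  also have "\<dots> = (\<Sum>w | f w \<noteq> 0. cst (f w) * occ i (\<lambda>u v. evw X (u @ i # v)) w)"
  proof (rule sum.cong[OF refl])
    fix w
    have "cst (euler i f w) * evw X w = cst (f w) * (cst (of_nat (count (mset w) i)) * evw X w)"
      unfolding euler_def gr.scale_scale by (simp only: mult.commute)
    then show "cst (euler i f w) * evw X w = cst (f w) * occ i (\<lambda>u v. evw X (u @ i # v)) w"
      unfolding occ_const[of i "evw X"] cst_of_nat .
  qed
  also have "\<dots> = (\<Sum>w | f w \<noteq> 0. cst (f w) * occ i (\<lambda>u v. evw X u * evw X (i # v) - evw X (i # v) * evw X u) w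
    + X i * (cst (f w) * occ i (\<lambda>u v. evw X v * evw X u) w))"
  proof (rule sum.cong[OF refl])
    fix w
    have "occ i (\<lambda>u v. evw X (u @ i # v)) w =
      occ i (\<lambda>u v. (evw X u * evw X (i # v) - evw X (i # v) * evw X u) + X i * (evw X v * evw X u)) w"
      by (simp add: mult.assoc)
    then show "cst (f w) * occ i (\<lambda>u v. evw X (u @ i # v)) w =
      cst (f w) * occ i (\<lambda>u v. evw X u * evw X (i # v) - evw X (i # v) * evw X u) w
      + X i * (cst (f w) * occ i (\<lambda>u v. evw X v * evw X u) w)"
      unfolding occ_add occ_mult[symmetric] mult_cst_left_commute[of "X i"] by (simp only: distrib_left)
  qed
  finally show ?thesis
    unfolding cyc_def sum.distrib sum_distrib_left .
qed

context odd_char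
begin

text \<open>Substituting \<open>X i + t\<close> for \<open>X i\<close> with a fresh nilpotent \<open>t\<close> shows that \<open>t * cyc X i f\<close> is
  even; taking \<open>t\<close> odd kills the even part of \<open>cyc X i f\<close>, and taking \<open>t\<close> even kills its odd part.\<close>

lemma cyc_eq_0:
  fixes X :: "nat \<Rightarrow> 'k gr"
  assumes f: "central_or_T f" and X: "\<And>i. X i \<in> G0"
  shows "cyc X i f = 0"
proof -
  let ?G = "cyc X i f"
  obtain n where n: "n > 0" "\<And>m S. n \<le> m \<Longrightarrow> gcoeff ?G S \<noteq> 0 \<Longrightarrow> m \<notin> S"
    using fresh_exists by blast
  have ev: "is_ev (t * ?G)" if t: "\<And>x. t * (x * t) = 0" "t \<in> G0" for t
  proof -
    let ?X = "X(i := X i + t)"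
    let ?D = "\<Sum>w | f w \<noteq> 0. cst (f w) * occ i (\<lambda>u v. evw X u * (t * evw X v)) w"
    let ?K = "\<Sum>w | f w \<noteq> 0. cst (f w) * occ i (\<lambda>u v. evw X u * (t * evw X v) - t * evw X v * evw X u) w"
    have XD: "evp ?X f = evp X f + ?D"
      unfolding evp_def evw_shift_var[of t X i, OF t(1)] distrib_left sum.distrib ..
    have X': "?X j \<in> G0" for j
      using X t(2) by (simp add: G0_add)
    have evp: "is_ev (evp Y f)" if "\<And>i. Y i \<in> G0" for Y
      using f that unfolding central_or_T_def by blast
    have "is_ev (evp ?X f - evp X f)"
      by (intro is_ev_diff evp X' X)
    then have D: "is_ev ?D"
      unfolding XD by simp
    have K: "is_ev ?K"
      by (intro is_ev_sum is_ev_mult is_ev_cst is_ev_occ is_ev_commutator)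
    \<comment> \<open>The variation \<open>?D\<close> of an even value is even, and so are the
      commutators in \<open>?K\<close> that move \<open>t\<close> to the front.\<close>
    have "?D - ?K = (\<Sum>w | f w \<noteq> 0. cst (f w) * occ i (\<lambda>u v. t * evw X v * evw X u) w)"
      unfolding sum_subtractf[symmetric] occ_diff right_diff_distrib by simp
    also have "\<dots> = t * ?G"
      unfolding cyc_def sum_distrib_left mult_cst_left_commute[of t] occ_mult[of t] mult.assoc ..
    finally show ?thesis
      using is_ev_diff[OF D K] by simp
  qed
  have en: "e m \<in> (G0 :: 'k gr set)" if "m \<ge> n" for m
    using that n(1) by (intro G0_bas) auto
  have split: "t * ?G = t * ev ?G + t * od ?G" for t
    unfolding distrib_left[symmetric] ev_od ..
  have sub: "gcoeff (ev ?G) S \<noteq> 0 \<Longrightarrow> gcoeff ?G S \<noteq> 0" "gcoeff (od ?G) S \<noteq> 0 \<Longrightarrow> gcoeff ?G S \<noteq> 0" for S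
    by (auto simp: ev.rep_eq od.rep_eq split: if_splits)
  have "ev ?G = 0"
  proof (rule e_cancel)
    have "is_ev (e n * ?G)"
      by (rule ev[OF od_sandwich[OF is_od_e] en]) simp
    moreover have "is_ev (e n * od ?G)"
      by (intro is_ev_mult_od is_od_e is_od_od)
    ultimately have "is_ev (e n * ev ?G)"
      using is_ev_diff[of "e n * ?G" "e n * od ?G"] by (simp add: split[of "e n"])
    moreover have "is_od (e n * ev ?G)"
      by (intro is_od_mult1 is_od_e is_ev_ev)
    ultimately show "e n * ev ?G = 0"
      by (rule is_ev_is_od_eq_0)
    show "n \<notin> S" if "gcoeff (ev ?G) S \<noteq> 0" for S
      by (rule n(2)[OF order_refl sub(1)[OF that]])
  qed
  moreover have "od ?G = 0"
  proof (rule e_cancel)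
    \<comment> \<open>The simplest even probe; its two generators are cancelled one after the
      other.\<close>
    let ?t = "e n * e (Suc n) :: 'k gr"
    have evt: "is_ev ?t"
      by (intro is_ev_mult_od is_od_e)
    have tt: "?t * (x * ?t) = 0" for x
    proof -
      have "?t * (x * ?t) = x * (?t * ?t)"
        by (rule ev_left_commute[OF evt, symmetric])
      also have "?t * ?t = e n * (e (Suc n) * e n) * e (Suc n)"
        by (simp only: mult.assoc)
      also have "\<dots> = 0"
        unfolding od_sandwich[OF is_od_e] by (rule mult_zero_left)
      finally show ?thesis by simp
    qed
    have "is_ev (?t * ?G)"
      by (rule ev[OF tt G0_mult[OF en en]]) simp_all
    moreover have "is_ev (?t * ev ?G)"
      by (intro is_ev_mult evt is_ev_ev)
    ultimately have "is_ev (?t * od ?G)"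
      using is_ev_diff[of "?t * ?G" "?t * ev ?G"] by (simp add: split[of ?t])
    moreover have "is_od (?t * od ?G)"
      by (intro is_od_mult2 evt is_od_od)
    ultimately have "?t * od ?G = 0"
      by (rule is_ev_is_od_eq_0)
    then have "e n * (e (Suc n) * od ?G) = 0"
      by (simp only: mult.assoc)
    then show "e (Suc n) * od ?G = 0"
    proof (rule e_cancel)
      fix S assume "gcoeff (e (Suc n) * od ?G) S \<noteq> 0"
      then obtain A B where AB: "S = A \<union> B" "gcoeff (e (Suc n) :: 'k gr) A \<noteq> 0" "gcoeff (od ?G) B \<noteq> 0"
        by (rule gcoeff_mult_nonzeroE)
      have "A = {Suc n}"
        using AB(2) by (auto simp: bas.rep_eq split: if_splits)
      moreover have "n \<notin> B"
        by (rule n(2)[OF order_refl sub(2)[OF AB(3)]])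
      ultimately show "n \<notin> S"
        using AB(1) by simp
    qed
    show "Suc n \<notin> S" if "gcoeff (od ?G) S \<noteq> 0" for S
      by (rule n(2)[OF le_SucI[OF order_refl] sub(2)[OF that]])
  qed
  ultimately show ?thesis
    using ev_od[of ?G] by simp
qed

lemma evp_euler_central:
  fixes X :: "nat \<Rightarrow> 'k gr"
  assumes "central_or_T f" "\<And>i. X i \<in> G0"
  shows "evp X (euler i f) = (\<Sum>w | f w \<noteq> 0. cst (f w) * occ i (\<lambda>u v. evw X u * evw X (i # v) - evw X (i # v) * evw X u) w)"
  using evp_euler[of f X i] cyc_eq_0[of f X i] assms unfolding central_or_T_def by simp

lemma central_or_T_euler: "central_or_T f \<Longrightarrow> central_or_T (euler i f)" for f :: "nat list \<Rightarrow> 'k"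
  unfolding central_or_T_def[of "euler i f"]
  by (auto simp only: evp_euler_central euler_ncpoly central_or_T_def[of f]
      intro!: is_ev_sum is_ev_mult is_ev_cst is_ev_occ is_ev_commutator)

lemma top_evp_euler:
  fixes X :: "nat \<Rightarrow> 'k gr"
  assumes N: "even N" and f: "central_or_T f" and X: "\<And>i. X i \<in> G0" "\<And>i. X i \<in> Gen"
  shows "gcoeff (evp X (euler i f)) (tops N) = 0"
proof -
  have "gcoeff (evw X u * evw X v - evw X v * evw X u) (tops N) = 0" for u v
    using top_trace[OF N Gen_evw_subst[of X u, OF X(2)] Gen_evw_subst[of X v, OF X(2)]] by simp
  then have "gcoeff (occ i (\<lambda>u v. evw X u * evw X (i # v) - evw X (i # v) * evw X u) w) (tops N) = 0" for w
    unfolding occ_def gcoeff_sum by (intro sum.neutral) (auto simp del: evw_simps)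
  then show ?thesis
    unfolding evp_euler_central[of f X, OF f X(1)] gcoeff_sum gcoeff_cst_mult by simp
qed

section \<open>Reduction to degrees divisible by the characteristic\<close>

lemma fermat_field: "(of_nat n :: 'k) ^ (p - 1) = (if p dvd n then 0 else 1)"
proof -
  have "(of_nat n :: 'k) ^ p = of_nat n"
  proof (induction n)
    case 0
    then show ?case using p_gt_2 by (simp add: power_0_left)
  next
    case (Suc n)
    have "(of_nat n + 1 :: 'k) ^ p = of_nat n ^ p + 1 ^ p"
      by (rule freshmans_dream) (use prime_p char_p in auto)
    then show ?case
      using Suc by (simp add: add.commute)
  qed
  then have *: "(of_nat n :: 'k) * of_nat n ^ (p - 1) = of_nat n"
    using p_gt_2 by (cases p) auto
  show ?thesis
  proof (cases "p dvd n")
    case True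
    then show ?thesis
      using of_nat_eq_0_iff[of n] p_gt_2 by (simp add: power_0_left)
  next
    case False
    then show ?thesis
      using * of_nat_eq_0_iff[of n] by simp
  qed
qed

lemma euler_power: "(euler i ^^ n) f = (\<lambda>w. of_nat (count (mset w) i) ^ n * f w)" for f :: "nat list \<Rightarrow> 'k"
  by (induction n) (auto simp: euler_def mult.assoc)

text \<open>By \<open>fermat_field\<close> the \<open>(p - 1)\<close>-th Euler iterate projects onto
  the words whose degree in \<open>i\<close> is prime to \<open>p\<close>. It is itself an Euler
  image of a polynomial with even values, so removing it keeps the top coefficient.\<close>

lemma central_reduction_step:
  fixes X :: "nat \<Rightarrow> 'k gr" and i :: nat
  assumes N: "even N" and f: "central_or_T f" and X: "\<And>i. X i \<in> G0" "\<And>i. X i \<in> Gen"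
  defines "g \<equiv> (\<lambda>w. if p dvd count (mset w) i then f w else 0)"
  shows "central_or_T g" "gcoeff (evp X g) (tops N) = gcoeff (evp X f) (tops N)"
proof -
  define h where "h = (euler i ^^ (p - 1)) f"
  have c: "central_or_T ((euler i ^^ n) f)" for n
    by (induction n) (use f central_or_T_euler in auto)
  have h: "h = euler i ((euler i ^^ (p - 2)) f)"
  proof -
    have "p - 1 = Suc (p - 2)"
      using p_gt_2 by simp
    then show ?thesis
      unfolding h_def by (simp only: funpow.simps(2) comp_apply)
  qed
  have g: "g = (\<lambda>w. f w - h w)"
    unfolding g_def h_def euler_power fermat_field by auto
  show "central_or_T g"
    unfolding g by (rule central_or_T_diff[OF f]) (simp only: h_def c)
  have "gcoeff (evp X h) (tops N) = 0"
    unfolding h by (rule top_evp_euler[OF N c X])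
  moreover have "f = (\<lambda>w. g w + h w)"
    unfolding g by simp
  moreover have "g \<in> ncpoly" "h \<in> ncpoly"
    using \<open>central_or_T g\<close> c unfolding h_def central_or_T_def by blast+
  ultimately show "gcoeff (evp X g) (tops N) = gcoeff (evp X f) (tops N)"
    using evp_add[of g h X] by (metis add_0_right plus_gr.rep_eq)
qed

lemma central_reduction:
  fixes X :: "nat \<Rightarrow> 'k gr"
  assumes N: "even N" and f: "central_or_T f" and X: "\<And>i. X i \<in> G0" "\<And>i. X i \<in> Gen" and "finite I"
  shows "\<exists>g. central_or_T g \<and> gcoeff (evp X g) (tops N) = gcoeff (evp X f) (tops N) \<and>
    (\<forall>w. g w \<noteq> 0 \<longrightarrow> f w \<noteq> 0 \<and> (\<forall>i\<in>I. p dvd count (mset w) i))"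
  using \<open>finite I\<close>
proof (induction I)
  case empty
  then show ?case
    using f by auto
next
  case (insert i I)
  then obtain g where g: "central_or_T g" "gcoeff (evp X g) (tops N) = gcoeff (evp X f) (tops N)"
    "\<forall>w. g w \<noteq> 0 \<longrightarrow> f w \<noteq> 0 \<and> (\<forall>i\<in>I. p dvd count (mset w) i)"
    by blast
  define g' where "g' = (\<lambda>w. if p dvd count (mset w) i then g w else 0)"
  have "central_or_T g'" "gcoeff (evp X g') (tops N) = gcoeff (evp X f) (tops N)"
    using central_reduction_step[of N g X i, OF N g(1) X] g(2) unfolding g'_def by simp_all
  moreover have "\<forall>w. g' w \<noteq> 0 \<longrightarrow> f w \<noteq> 0 \<and> (\<forall>i\<in>insert i I. p dvd count (mset w) i)"
    using g(3) by (auto simp: g'_def)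
  ultimately show ?case
    by blast
qed

text \<open>Expansion yields products of one class per letter. An even number of them, below
  \<open>N\<close>, is covered by \<open>top_prod_q\<close>; an odd number gives an odd element,
  whereas \<open>tops N\<close> has even size.\<close>

lemma top_evw_eq_0:
  fixes X :: "nat \<Rightarrow> 'k gr"
  assumes N: "even N" and X: "\<And>i. X i \<in> G0" "\<And>i. X i \<in> Gen"
    and w: "\<And>i. p dvd count (mset w) i" "card (set w) < N"
  shows "gcoeff (evw X w) (tops N) = 0"
proof -
  have 1: "1 * ev (evw X w) + 1 * od (evw X w) \<in> gr.span (parts X ([] @ w))"
    using span_parts_append[OF one_in_parts, of X w] by (intro gr.span_add) blast+
  have "evw X w \<in> gr.span (parts X w)"
    using 1 unfolding mult_1_left ev_od append_Nil .
  then show ?thesis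
  proof (induction rule: gr.span_induct_alt)
    case (step c x y)
    have "gcoeff x (tops N) = 0"
      using parts_cases[of X, OF X(1) w(1) step.hyps(1)]
    proof
      assume "\<exists>es. distinct es \<and> set es = set w \<and> x = prod_list (map (\<lambda>i. q (X i)) es)"
      then obtain es where es: "distinct es" "set es = set w" "x = prod_list (map q (map X es))"
        by (auto simp: comp_def)
      show ?thesis
      proof (cases "even (length es)")
        case True
        have "length es < N"
          using es(1,2) w(2) by (metis distinct_card)
        then show ?thesis
          using top_prod_q[OF N, of "[]" "map X es"] X(2) True unfolding es(3) by auto
      next
        case False
        then have "is_od x"
          unfolding es(3) by (intro is_od_prod_q) simp
        then show ?thesis
          using N even_card_top[of N] unfolding is_od_def by blast
      qed
    qed simp
    then show ?case
      using step.IH by simp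
  qed simp
qed

text \<open>After the reduction each word has all degrees divisible by \<open>p\<close> and at most
  \<open>card I\<close> distinct letters.\<close>

lemma top_evp_central_eq_0:
  fixes X :: "nat \<Rightarrow> 'k gr"
  assumes N: "even N" and f: "central_or_T f" and X: "\<And>i. X i \<in> G0" "\<And>i. X i \<in> Gen"
    and I: "finite I" "\<And>w. f w \<noteq> 0 \<Longrightarrow> set w \<subseteq> I" "card I < N"
  shows "gcoeff (evp X f) (tops N) = 0"
proof -
  obtain g where g: "gcoeff (evp X g) (tops N) = gcoeff (evp X f) (tops N)"
    "\<And>w. g w \<noteq> 0 \<Longrightarrow> f w \<noteq> 0 \<and> (\<forall>i\<in>I. p dvd count (mset w) i)"
    using central_reduction[of N f X I, OF N f X I(1)] by blast
  have "gcoeff (evw X w) (tops N) = 0" if "g w \<noteq> 0" for w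
  proof (rule top_evw_eq_0[OF N X])
    have w: "set w \<subseteq> I"
      using that g(2) I(2) by blast
    show "p dvd count (mset w) i" for i
    proof (cases "i \<in> I")
      case True
      then show ?thesis using g(2)[OF that] by blast
    next
      case False
      then have "count (mset w) i = 0"
        using w by (auto simp: count_eq_zero_iff)
      then show ?thesis
        by (simp only: dvd_0_right)
    qed
    show "card (set w) < N"
      using card_mono[OF I(1) w] I(3) by simp
  qed
  then have "gcoeff (evp X g) (tops N) = 0"
    unfolding evp_def gcoeff_sum gcoeff_cst_mult by (intro sum.neutral) auto
  then show ?thesis
    using g(1) by simp
qed

subsection \<open>Central polynomials with nonzero top coefficient\<close>

text \<open>\<open>wpoly1 a b\<close> is \<open>x_a^(p-1) [x_a, x_b] x_b^(p-1)\<close>.\<close>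

definition wpoly1 :: "nat \<Rightarrow> nat \<Rightarrow> nat list \<Rightarrow> 'k" where
  "wpoly1 a b = (\<lambda>w. mon (replicate p a @ replicate p b) w
    - mon (replicate (p - 1) a @ [b, a] @ replicate (p - 1) b) w)"

text \<open>Has \<open>2 * Suc n\<close> variables. The product starts with one factor because the
  nonunitary algebra has no empty product.\<close>

primrec wpoly :: "nat \<Rightarrow> nat list \<Rightarrow> 'k" where
  "wpoly 0 = wpoly1 0 1"
| "wpoly (Suc n) = ncmult (wpoly n) (wpoly1 (2 * Suc n) (Suc (2 * Suc n)))"

lemma wpoly1_ncpoly: "wpoly1 a b \<in> ncpoly"
  unfolding wpoly1_def using p_gt_2 by (intro ncpoly_diff mon_ncpoly) auto

lemma wpoly_ncpoly: "wpoly n \<in> ncpoly"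
  by (induction n) (auto intro: wpoly1_ncpoly)

lemma evw_replicate: "evw X (replicate n a) = X a ^ n"
  by (induction n) auto

text \<open>The commutator supplies both odd parts, next to which the powers of the values reduce to
  powers of their even parts.\<close>

lemma evp_wpoly1: "evp X (wpoly1 a b) = cst 2 * (q (X a) * q (X b))"
proof -
  let ?u = "replicate p a @ replicate p b" and ?v = "replicate (p - 1) a @ [b, a] @ replicate (p - 1) b"
  define m where "m = p - 1"
  have p: "p = Suc m" and p1: "p - 1 = m"
    using p_gt_2 by (simp_all add: m_def)
  have uv: "mon ?u \<in> ncpoly" "(\<lambda>w. - 1 * mon ?v w :: 'k) \<in> ncpoly"
    using p_gt_2 by (intro mon_ncpoly ncpoly_weight; simp)+
  have "evp X (wpoly1 a b) = evw X ?u - evw X ?v"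
    using evp_add[OF uv, of X] unfolding wpoly1_def evp_scale cst_minus_1 by simp
  also have "\<dots> = X a ^ m * (X a * X b - X b * X a) * X b ^ m"
    unfolding evw_simps evw_replicate p1 unfolding p power_Suc2[of "X a"] power_Suc[of "X b"]
    by (simp only: left_diff_distrib right_diff_distrib mult.assoc mult_1_left)
  also have "X a * X b - X b * X a = cst 2 * (od (X a) * od (X b))"
    using commutator_eq[of "X a" "X b"] cst_of_nat[of 2, where 'a = 'k] by simp
  also have "X a ^ m * (cst 2 * (od (X a) * od (X b))) * X b ^ m = cst 2 * (X a ^ m * (od (X a) * (od (X b) * X b ^ m)))"
    unfolding mult_cst_left_commute[of "X a ^ m"] by (simp only: mult.assoc)
  also have "od (X b) * X b ^ m = q (X b)"
    using od_power_absorb[of "X b" 1 m] unfolding q_def p1 by (simp only: mult_1_left)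
  also have "X a ^ m * (od (X a) * q (X b)) = od (X a) * (q (X b) * X a ^ m)"
  proof -
    have "is_ev (od (X a) * q (X b))"
      by (intro is_ev_mult_od is_od_od is_od_q)
    then show ?thesis
      using ev_commute[of "od (X a) * q (X b)" "X a ^ m"] by (simp only: mult.assoc)
  qed
  also have "\<dots> = od (X a) * (q (X b) * ev (X a) ^ m)"
    by (rule od_power_absorb)
  also have "\<dots> = q (X a) * q (X b)"
    unfolding q_def[of "X a"] p1 mult.assoc ev_commute[OF is_ev_power[OF is_ev_ev], of "X a" m "q (X b)"] ..
  finally show ?thesis .
qed

lemma evp_wpoly: "evp X (wpoly n) = cst (2 ^ Suc n) * prod_list (map (\<lambda>i. q (X i)) [0..<2 * Suc n])"
proof (induction n)
  case 0
  have "[0..<2 * Suc 0] = [0, 1]"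
    by (simp add: numeral_2_eq_2)
  then show ?case
    by (simp add: evp_wpoly1)
next
  case (Suc n)
  have upt: "[0..<2 * Suc (Suc n)] = [0..<2 * Suc n] @ [2 * Suc n, Suc (2 * Suc n)]"
    by (simp add: numeral_2_eq_2)
  have pow: "(2 :: 'k) ^ Suc (Suc n) = 2 ^ Suc n * 2"
    by (simp only: power_Suc mult.commute)
  have "evp X (wpoly (Suc n)) = evp X (wpoly n) * evp X (wpoly1 (2 * Suc n) (Suc (2 * Suc n)))"
    unfolding wpoly.simps by (rule evp_mult[OF wpoly_ncpoly wpoly1_ncpoly])
  then show ?case
    unfolding upt pow
    by (simp only: Suc evp_wpoly1 cst_mult_cst_mult map_append prod_list.append list.map
        prod_list.Cons prod_list.Nil mult_1_right)
qed

lemma top_wpoly: "gcoeff (evp gen (wpoly n)) (tops (2 * Suc n)) \<noteq> 0"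
  unfolding evp_wpoly gcoeff_cst_mult using prod_q_gen_top[of "2 * Suc n"] two_neq_0 by (simp del: mult_Suc_right upt_Suc)

lemma central_poly_wpoly: "central_poly (wpoly n)"
  unfolding central_poly_def
proof (intro conjI allI impI)
  show "wpoly n \<in> ncpoly"
    by (rule wpoly_ncpoly)
  show "wpoly n \<notin> T_G0"
  proof
    assume "wpoly n \<in> T_G0"
    then have "gcoeff (evp gen (wpoly n)) = (\<lambda>S. 0)"
      using g_hom_evp[of gen] unfolding T_G0_def by auto
    then show False
      using top_wpoly[of n] by simp
  qed
  fix h :: "(nat list \<Rightarrow> 'k) \<Rightarrow> nat set \<Rightarrow> 'k" assume "g_hom h"
  then obtain X where X: "\<And>i. X i \<in> G0" "\<And>f. f \<in> ncpoly \<Longrightarrow> h f = gcoeff (evp X f)"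
    by (rule g_hom_eq_evp) metis
  have "is_ev (evp X (wpoly n))"
    unfolding evp_wpoly using is_ev_prod_q[of "map X [0..<2 * Suc n]"]
    by (intro is_ev_mult is_ev_cst) (simp add: comp_def)
  then show "h (wpoly n) \<in> centre_G0"
    unfolding X(2)[OF wpoly_ncpoly] by (subst centre_iff[OF evp_G0[OF wpoly_ncpoly X(1)]])
qed

subsection \<open>The filtration\<close>

text \<open>Quantifying over all endomorphisms builds their closure property into the set. Only even
  numbers of blocks are tested, since the trace property is available only for these.\<close>

definition V :: "nat \<Rightarrow> (nat list \<Rightarrow> 'k) set" where
  "V m = {f \<in> ncpoly. \<forall>h n. nc_endo h \<longrightarrow> m < 2 * n \<longrightarrow> gcoeff (evp gen (h f)) (tops (2 * n)) = 0}"

lemma nc_endo_comp: "nc_endo h \<Longrightarrow> nc_endo h' \<Longrightarrow> nc_endo (\<lambda>f. h (h' f))"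
  unfolding nc_endo_def by auto

lemma nc_endo_id: "nc_endo (\<lambda>f. f)"
  unfolding nc_endo_def by blast

lemma T_space_V: "T_space (V m)"
  unfolding T_space_def
proof (intro conjI ballI allI impI)
  have endo: "h f \<in> ncpoly" "h (\<lambda>w. f w + g w) = (\<lambda>w. h f w + h g w)" "h (\<lambda>w. c * f w) = (\<lambda>w. c * h f w)"
    if "nc_endo h" "f \<in> ncpoly" "g \<in> ncpoly" for h and f g :: "nat list \<Rightarrow> 'k" and c
    using that unfolding nc_endo_def by blast+
  show "V m \<subseteq> ncpoly"
    unfolding V_def by blast
  have "evp gen (h (\<lambda>w. 0)) = 0" if "nc_endo h" for h :: "(nat list \<Rightarrow> 'k) \<Rightarrow> nat list \<Rightarrow> 'k"
    using endo(3)[OF that ncpoly_0 ncpoly_0, of 0] by (simp add: evp_def)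
  then show "(\<lambda>w. 0) \<in> V m"
    unfolding V_def by simp
  show "(\<lambda>w. f w + g w) \<in> V m" if "f \<in> V m" "g \<in> V m" for f g
    using that unfolding V_def by (auto simp: endo evp_add)
  show "(\<lambda>w. c * f w) \<in> V m" if "f \<in> V m" for c f
    using that unfolding V_def by (auto simp: endo evp_scale)
  show "h f \<in> V m" if "nc_endo h" "f \<in> V m" for h f
    using that nc_endo_comp[OF _ that(1)] unfolding V_def by (auto simp: endo(1))
qed

lemma V_mono: "m \<le> n \<Longrightarrow> V m \<subseteq> V n"
  unfolding V_def by auto

lemma T_space_Union_V: "T_space (\<Union>m. V m)"
proof -
  have T: "V m \<subseteq> ncpoly" "(\<lambda>w. 0) \<in> V m"
    "f \<in> V m \<Longrightarrow> g \<in> V m \<Longrightarrow> (\<lambda>w. f w + g w) \<in> V m" "f \<in> V m \<Longrightarrow> (\<lambda>w. c * f w) \<in> V m"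
    "nc_endo h \<Longrightarrow> f \<in> V m \<Longrightarrow> h f \<in> V m" for m f g c h
    using T_space_V[of m] unfolding T_space_def by simp_all
  show ?thesis
    unfolding T_space_def
  proof (intro conjI ballI allI impI)
    show "(\<Union>m. V m) \<subseteq> ncpoly"
      using T(1) by (rule UN_least)
    show "(\<lambda>w. 0) \<in> (\<Union>m. V m)"
      using T(2) by (rule UN_I[OF UNIV_I])
    show "(\<lambda>w. f w + g w) \<in> (\<Union>m. V m)" if fg: "f \<in> (\<Union>m. V m)" "g \<in> (\<Union>m. V m)" for f g
    proof -
      obtain m n where "f \<in> V m" "g \<in> V n"
        using fg by blast
      then have "f \<in> V (max m n)" "g \<in> V (max m n)"
        using V_mono[of m "max m n"] V_mono[of n "max m n"] by auto
      then have "(\<lambda>w. f w + g w) \<in> V (max m n)"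
        by (rule T(3))
      then show ?thesis
        by (rule UN_I[OF UNIV_I])
    qed
    show "(\<lambda>w. c * f w) \<in> (\<Union>m. V m)" if "f \<in> (\<Union>m. V m)" for c f
      using that by (auto intro: T(4))
    show "h f \<in> (\<Union>m. V m)" if "nc_endo h" "f \<in> (\<Union>m. V m)" for h f
      using that by (auto intro: T(5))
  qed
qed

lemma wpoly_notin_V: "wpoly m \<notin> V m"
proof
  assume "wpoly m \<in> V m"
  then have "nc_endo h \<Longrightarrow> m < 2 * n \<Longrightarrow> gcoeff (evp gen (h (wpoly m))) (tops (2 * n)) = 0" for h n
    unfolding V_def by blast
  \<comment> \<open>\<open>wpoly m\<close> involves \<open>2 * Suc m\<close> variables, a number
    that exceeds \<open>m\<close>, and its top coefficient is already nonzero without a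
    substitution.\<close>
  from this[OF nc_endo_id, of "Suc m"] show False
    using top_wpoly[of m] by simp
qed

lemma central_poly_in_V:
  assumes "central_poly f"
  shows "\<exists>m. f \<in> V m"
proof -
  have f: "f \<in> ncpoly" "\<And>h. g_hom h \<Longrightarrow> h f \<in> centre_G0"
    using assms unfolding central_poly_def by blast+
  have c: "central_or_T f"
    unfolding central_or_T_def
  proof (intro conjI allI impI)
    fix X :: "nat \<Rightarrow> 'k gr" assume X: "\<forall>i. X i \<in> G0"
    then have "gcoeff (evp X f) \<in> centre_G0"
      by (intro f(2) g_hom_evp) blast
    then show "is_ev (evp X f)"
      using centre_iff[OF evp_G0[OF f(1)], of X] X by blast
  qed (rule f(1))
  define I where "I = (\<Union>w\<in>{w. f w \<noteq> 0}. set w)"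
  have I: "finite I" "\<And>w. f w \<noteq> 0 \<Longrightarrow> set w \<subseteq> I"
    unfolding I_def using ncpoly_finite[OF f(1)] by auto
  have "gcoeff (evp gen (h f)) (tops (2 * n)) = 0" if h: "nc_endo h" and n: "card I < 2 * n" for h n
  proof -
    \<comment> \<open>Substituting and then evaluating generically is evaluation at a new point
      \<open>X\<close>. Its values are generic values of the polynomials \<open>h (mon [i])\<close>,
      hence lie in \<open>Gen\<close>.\<close>
    have "g_hom (\<lambda>g. gcoeff (evp gen (h g)))"
      using g_hom_evp[of gen] h unfolding g_hom_def nc_endo_def by auto
    then obtain X where X: "\<And>i. X i \<in> G0" "\<And>g. g \<in> ncpoly \<Longrightarrow> gcoeff (evp gen (h g)) = gcoeff (evp X g)"
      by (rule g_hom_eq_evp) metis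
    have "X i = evp gen (h (mon [i]))" for i
      using X(2)[OF mon_ncpoly, of "[i]"] by (simp add: gcoeff_inject)
    then have "X i \<in> Gen" for i
      by (simp add: evp_Gen)
    then show ?thesis
      unfolding X(2)[OF f(1)] using c X(1) I n by (intro top_evp_central_eq_0[of _ _ _ I]) auto
  qed
  then have "f \<in> V (card I)"
    unfolding V_def using f(1) by blast
  then show ?thesis ..
qed

lemma T_closure_least: "T_space W \<Longrightarrow> H \<subseteq> W \<Longrightarrow> T_closure H \<subseteq> W"
  unfolding T_closure_def by blast

lemma T_closure_superset: "H \<subseteq> T_closure H"
  unfolding T_closure_def by blast

lemma finite_subset_V: "finite H \<Longrightarrow> H \<subseteq> (\<Union>m. V m) \<Longrightarrow> \<exists>m. H \<subseteq> V m"
proof (induction H rule: finite_induct)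
  case (insert f H)
  then obtain m n where "H \<subseteq> V m" "f \<in> V n"
    by blast
  then have "insert f H \<subseteq> V (max m n)"
    using V_mono[of m "max m n"] V_mono[of n "max m n"] by auto
  then show ?case ..
qed simp

lemma not_finitely_based: "\<not> finitely_based (CP_G0 :: (nat list \<Rightarrow> 'k) set)"
proof
  assume "finitely_based (CP_G0 :: (nat list \<Rightarrow> 'k) set)"
  then obtain H where H: "finite H" "(CP_G0 :: (nat list \<Rightarrow> 'k) set) = T_closure H"
    unfolding finitely_based_def by blast
  have "(CP_G0 :: (nat list \<Rightarrow> 'k) set) \<subseteq> (\<Union>m. V m)"
    unfolding CP_G0_def using central_poly_in_V by (intro T_closure_least T_space_Union_V) blast
  then have "H \<subseteq> (\<Union>m. V m)"
    using H(2) T_closure_superset by blast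
  then obtain m where "H \<subseteq> V m"
    using finite_subset_V[OF H(1)] by blast
  then have "(CP_G0 :: (nat list \<Rightarrow> 'k) set) \<subseteq> V m"
    unfolding H(2) by (rule T_closure_least[OF T_space_V])
  moreover have "wpoly m \<in> CP_G0"
    unfolding CP_G0_def using T_closure_superset central_poly_wpoly by blast
  ultimately show False
    using wpoly_notin_V by blast
qed

end

theorem theorem2p2:
  fixes p :: nat
  assumes "prime p" and "p > 2" and "CHAR('k::field) = p"
  shows "\<not> finitely_based (CP_G0 :: (nat list \<Rightarrow> 'k) set)"
proof -
  interpret odd_char p "TYPE('k)"
    using assms by unfold_locales
  show ?thesis
    by (rule not_finitely_based)
qed

end
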